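(* Let $f$ be a Bernstein function satisfying the standing assumptions of the context, with associated Sonine pair $(\bar\mu,k)$. Assume that the limit $q=\lim_{x\to 0}\bar\mu(x)\int_0^x k(s)\,ds$ satisfies $q<1$, and assume moreover that $f$ is unbounded. Let $T>0$. Then for any $\phi_0\in\mathbb R$ and $\lambda\in\mathbb R$, the initial value problem $$D^{\mathrm{Ce}}\phi(x)=\lambda\phi(x),\quad x\in(0,T],\qquad \phi(0)=\phi_0,$$ has a unique solution $\phi$ in $C_{\bar\mu}[0,T]$, and it is given by $$\phi(x)=\phi_0\sum_{j=0}^\infty \big((\lambda I^{\mathrm{Ce}})^j\mathbf 1\big)(x),$$ where $\mathbf 1$ is the constant function $1$.
   Context: Standing assumptions. $f$ is a complete Bernstein function with characteristics $(0,\mu)$: $f(\lambda)=\int_0^\infty(1-e^{-\lambda x})\,\mu(dx)$ for $\lambda>0$, where $\mu$ is a measure on $(0,\infty)$ with $\int_0^\infty\min\{1,x\}\,\mu(dx)<\infty$ which has a completely monotone density with respect to Lebesgue measure. Moreover $\lim_{\lambda\to0}\frac1{f(\lambda)}=\infty$, $\lim_{\lambda\to\infty}\frac1{f(\lambda)}=0$, $\lim_{\lambda\to0}\frac{\lambda}{f(\lambda)}=0$, $\lim_{\lambda\to\infty}\frac{\lambda}{f(\lambda)}=\infty$. Put $\bar\mu(s)=\mu(s,\infty)$, so that $\int_0^\infty e^{-\lambda x}\bar\mu(x)\,dx=f(\lambda)/\lambda$, and let $k:(0,\infty)\to[0,\infty)$ be the (completely monotone) potential density, determined by $\int_0^\infty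 e^{-\lambda x}k(x)\,dx=1/f(\lambda)$. The functions $(\bar\mu,k)$ form a Sonine pair: $\int_0^x\bar\mu(s)k(x-s)\,ds=1$ for all $x>0$. Function spaces: $C_{\bar\mu}(0,T]=\{\varphi\in C(0,T]\cap L^1(0,T]:\ \bar\mu*\varphi\in C^1(0,T]\}$, where $(\bar\mu*\varphi)(x)=\int_0^x\bar\mu(x-s)\varphi(s)\,ds$, and $C_{\bar\mu}[0,T]=C[0,T]\cap C_{\bar\mu}(0,T]$. Operators: $D^{\mathrm R}\varphi(x)=\frac{d}{dx}\int_0^x\varphi(s)\bar\mu(x-s)\,ds$ for $\varphi\in C_{\bar\mu}(0,T]$ (Bernstein Riemann--Liouville derivative); $I^{\mathrm R}\varphi(x)=\int_0^x\varphi(s)k(x-s)\,ds$ for $\varphi\in C(0,T]\cap L^1(0,T]$ (Bernstein Riemann--Liouville integral). The censored Bernstein fractional derivative of $\varphi\in C_{\bar\mu}(0,T]$ is $D^{\mathrm{Ce}}\varphi(x)=D^{\mathrm R}\varphi(x)-\varphi(x)\bar\mu(x)$, $x\in(0,T]$. For $\varphi\in C[0,T]$ put $\mathcal K\varphi(x)=\int_0^x\bar\mu(r)k(x-r)\varphi(r)\,dr$ for $x>0$ and $\mathcal K\varphi(0)=\varphi(0)$; $\mathcal K^0$ is the identity. When $q<1$, the censored integral of $g\in C[0,T]$ is $I^{\mathrm{Ce}}g=\sum_{j=0}^\infty\mathcal K^jI^{\mathrm R}g$ (with $I^{\mathrm R}g(0)=0$); this series converges and $I^{\mathrm{Ce}}$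 maps $C[0,T]$ into $C_{\bar\mu}[0,T]$. *)

theory Defs
  imports "HOL-Analysis.Analysis"
begin

text \<open>
  Functions on \<open>(0,\<infinity>)\<close>, \<open>(0,T]\<close> or \<open>[0,T]\<close> are represented by total functions on the reals.
  Every notion below reads only their values on the stated domain.
\<close>

definition completely_monotone :: "(real \<Rightarrow> real) \<Rightarrow> bool" where
  "completely_monotone g \<longleftrightarrow>
     (\<forall>n. \<forall>x>0. (deriv ^^ n) g differentiable (at x) \<and> 0 \<le> (-1) ^ n * (deriv ^^ n) g x)"

text \<open>
  A measure on \<open>(0,\<infinity>)\<close> is a Borel measure on the reals for which \<open>{..0}\<close> is a null set.
  On \<open>(0,\<infinity>)\<close> the function \<open>min 1 x\<close> is nonnegative, so its integrability is finiteness of the integral.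
\<close>

definition levy_measure :: "real measure \<Rightarrow> bool" where
  "levy_measure \<mu> \<longleftrightarrow>
     sets \<mu> = sets borel \<and> emeasure \<mu> {..0} = 0 \<and> integrable \<mu> (\<lambda>x. min 1 x)"

text \<open>Characteristics \<open>(0,\<mu>)\<close>: neither a killing nor a drift term, only the measure \<open>\<mu>\<close>.\<close>

definition complete_bernstein :: "(real \<Rightarrow> real) \<Rightarrow> real measure \<Rightarrow> bool" where
  "complete_bernstein f \<mu> \<longleftrightarrow>
     levy_measure \<mu> \<and>
     (\<exists>m. completely_monotone m \<and>
          \<mu> = density lborel (\<lambda>x. ennreal (indicator {0<..} x * m x))) \<and>
     (\<forall>l>0. f l = (LINT x|\<mu>. 1 - exp (- l * x)))"

definition tail :: "real measure \<Rightarrow> real \<Rightarrow> real" where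
  "tail \<mu> s = measure \<mu> {s<..}"

definition potential_density :: "(real \<Rightarrow> real) \<Rightarrow> (real \<Rightarrow> real) \<Rightarrow> bool" where
  "potential_density f k \<longleftrightarrow>
     completely_monotone k \<and>
     (\<forall>l>0. set_integrable lborel {0<..} (\<lambda>x. exp (- l * x) * k x) \<and>
            (LINT x:{0<..}|lborel. exp (- l * x) * k x) = 1 / f l)"

definition conv :: "(real \<Rightarrow> real) \<Rightarrow> (real \<Rightarrow> real) \<Rightarrow> real \<Rightarrow> real" where
  "conv g h x = (LINT s:{0<..<x}|lborel. g (x - s) * h s)"

text \<open>\<open>C\<^sup>1(0,T]\<close>, with the one-sided derivative at \<open>T\<close>.\<close>

definition C1_on :: "real \<Rightarrow> (real \<Rightarrow> real) \<Rightarrow> bool" where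
  "C1_on T u \<longleftrightarrow>
     (\<exists>u'. continuous_on {0<..T} u' \<and>
           (\<forall>x\<in>{0<..T}. (u has_real_derivative u' x) (at x within {0<..T})))"

text \<open>
  In what follows \<open>m\<close> is the tail of the measure and \<open>k\<close> the potential density.
  The two spaces are \<open>C\<^sub>m(0,T]\<close> and \<open>C\<^sub>m[0,T]\<close>.
\<close>

definition C_Ioc :: "(real \<Rightarrow> real) \<Rightarrow> real \<Rightarrow> (real \<Rightarrow> real) set" where
  "C_Ioc m T = {\<phi>. continuous_on {0<..T} \<phi> \<and> set_integrable lborel {0<..T} \<phi> \<and>
                   C1_on T (conv m \<phi>)}"

definition C_Icc :: "(real \<Rightarrow> real) \<Rightarrow> real \<Rightarrow> (real \<Rightarrow> real) set" where
  "C_Icc m T = {\<phi>. continuous_on {0..T} \<phi>} \<inter> C_Ioc m T"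

text \<open>
  The derivative is taken within \<open>(0,T]\<close>, so that at \<open>x = T\<close> it does not depend on the values of
  \<open>\<phi>\<close> beyond \<open>T\<close>.
\<close>

definition D_R :: "(real \<Rightarrow> real) \<Rightarrow> real \<Rightarrow> (real \<Rightarrow> real) \<Rightarrow> real \<Rightarrow> real" where
  "D_R m T \<phi> x = vector_derivative (conv m \<phi>) (at x within {0<..T})"

definition D_Ce :: "(real \<Rightarrow> real) \<Rightarrow> real \<Rightarrow> (real \<Rightarrow> real) \<Rightarrow> real \<Rightarrow> real" where
  "D_Ce m T \<phi> x = D_R m T \<phi> x - \<phi> x * m x"

definition I_R :: "(real \<Rightarrow> real) \<Rightarrow> (real \<Rightarrow> real) \<Rightarrow> real \<Rightarrow> real" where
  "I_R k \<phi> x = conv k \<phi> x"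

definition K_op :: "(real \<Rightarrow> real) \<Rightarrow> (real \<Rightarrow> real) \<Rightarrow> (real \<Rightarrow> real) \<Rightarrow> real \<Rightarrow> real" where
  "K_op m k \<phi> x =
     (if x = 0 then \<phi> 0 else (LINT r:{0<..<x}|lborel. m r * k (x - r) * \<phi> r))"

definition I_Ce :: "(real \<Rightarrow> real) \<Rightarrow> (real \<Rightarrow> real) \<Rightarrow> (real \<Rightarrow> real) \<Rightarrow> real \<Rightarrow> real" where
  "I_Ce m k g x = (\<Sum>j. (K_op m k ^^ j) (I_R k g) x)"

definition solves_ivp ::
    "(real \<Rightarrow> real) \<Rightarrow> real \<Rightarrow> real \<Rightarrow> real \<Rightarrow> (real \<Rightarrow> real) \<Rightarrow> bool" where
  "solves_ivp m T l \<phi>0 \<phi> \<longleftrightarrow>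
     \<phi> \<in> C_Icc m T \<and> (\<forall>x\<in>{0<..T}. D_Ce m T \<phi> x = l * \<phi> x) \<and> \<phi> 0 = \<phi>0"

end

theory Submission imports Defs begin

text \<open>
  Write \<open>m\<close> for the tail of the measure and \<open>\<kappa>(x)\<close> for the integral of \<open>k\<close> over \<open>(0,x)\<close>. The Sonine identity
  \<open>m * k = 1\<close> turns the initial value problem into \<open>\<phi> = \<K>\<phi> + \<lambda> (k * \<phi>)\<close>, where \<open>\<K>\<close> averages against
  a probability kernel. As \<open>m\<close> is strictly decreasing, \<open>m \<kappa> < m * k = 1\<close> pointwise, and with the hypothesis on the
  limit at \<open>0\<close> this gives \<open>m \<kappa> \<le> q' < 1\<close> on \<open>(0,T]\<close>. Hence \<open>\<K>\<close> multiplies each weight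
  \<open>\<kappa>\<^sub>\<beta> = k * exp(\<beta> \<cdot>)\<close> by at most \<open>q'\<close>, so the Neumann series of \<open>\<K>\<close> converges on functions bounded by
  \<open>\<kappa>\<^sub>\<beta>\<close>. Since \<open>\<kappa>\<^sub>\<beta> \<le> exp(\<beta> \<cdot>) / f(\<beta>)\<close> and \<open>f(\<beta>) \<rightarrow> \<infinity>\<close>, the operator \<open>\<lambda> I\<^sup>C\<^sup>e\<close> is a
  contraction in the weight \<open>exp(\<beta> \<cdot>)\<close> for large \<open>\<beta>\<close>, and a second Neumann series gives the solution.
\<close>

section \<open>Convolutions on the half-line\<close>

text \<open>The kernel of \<open>\<K>\<close> has mass one, so \<open>\<K>\<close> fixes the
  constants: it is no contraction in the supremum norm, and
  \<open>\<phi> = \<K> \<phi> + \<lambda> (k * \<phi>)\<close> leaves \<open>\<phi> 0\<close> free.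
  Hence the initial value is split off: \<open>w = \<phi> - \<phi>0\<close> vanishes at
  \<open>0\<close> and solves \<open>w = \<K> w + \<lambda> (k * \<phi>)\<close>, which becomes
  \<open>\<phi> = \<phi>0 + \<lambda> I_Ce \<phi>\<close>. For this step \<open>w\<close> must be
  unique among all continuous functions with \<open>w 0 = 0\<close>. Such functions need not be
  bounded by a multiple of \<open>\<kappa>\<close>, which itself vanishes at \<open>0\<close>, so
  the Neumann series alone does not give uniqueness; a truncation argument does
  (\<open>K_fixed_point_zero\<close>). The Sonine identity is proved, not assumed: the transforms
  \<open>f(\<lambda>)/\<lambda>\<close> of the tail and \<open>1/f(\<lambda>)\<close> of
  \<open>k\<close> multiply to \<open>1/\<lambda>\<close>, the transform of \<open>1\<close>.
  Finally, the given \<open>q\<close> is only a limit at \<open>0\<close>, while the contraction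
  needs a bound on all of \<open>(0,T]\<close>; the strict decrease of the tail, which rests on
  \<open>\<lambda>/f(\<lambda>) \<rightarrow> 0\<close>, closes this gap.\<close>

lemma set_integral_reflect:
  fixes F :: "real \<Rightarrow> real"
  shows "(LINT s:{0<..<x}|lborel. F (x - s)) = (LINT s:{0<..<x}|lborel. F s)"
proof -
  have "(LINT s:{0<..<x}|lborel. F s) =
      \<bar>-1\<bar> *\<^sub>R (\<integral>s. indicator {0<..<x} (x + (-1) * s) *\<^sub>R F (x + (-1) * s) \<partial>lborel)"
    unfolding set_lebesgue_integral_def by (rule lborel_integral_real_affine) simp
  also have "\<dots> = (LINT s:{0<..<x}|lborel. F (x - s))"
    unfolding set_lebesgue_integral_def by (auto intro!: Bochner_Integration.integral_cong simp: indicator_def)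
  finally show ?thesis by simp
qed

lemma set_integrable_reflect:
  fixes F :: "real \<Rightarrow> real"
  shows "set_integrable lborel {0<..<x} (\<lambda>s. F (x - s)) \<longleftrightarrow> set_integrable lborel {0<..<x} F"
proof -
  have "set_integrable lborel {0<..<x} F \<longleftrightarrow>
      integrable lborel (\<lambda>s. indicator {0<..<x} (x + (-1) * s) *\<^sub>R F (x + (-1) * s))"
    unfolding set_integrable_def by (rule lborel_integrable_real_affine_iff[symmetric]) simp
  also have "\<dots> \<longleftrightarrow> set_integrable lborel {0<..<x} (\<lambda>s. F (x - s))"
    unfolding set_integrable_def by (intro Bochner_Integration.integrable_cong) (auto simp: indicator_def)
  finally show ?thesis by simp
qed

lemma set_integral_shift:
  fixes F :: "real \<Rightarrow> real"
  shows "(LINT s:{r<..<x}|lborel. F (s - r)) = (LINT s:{0<..<x - r}|lborel. F s)"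
proof -
  have "(LINT s:{r<..<x}|lborel. F (s - r)) =
      \<bar>1\<bar> *\<^sub>R (\<integral>s. indicator {r<..<x} (r + 1 * s) *\<^sub>R F (r + 1 * s - r) \<partial>lborel)"
    unfolding set_lebesgue_integral_def by (rule lborel_integral_real_affine) simp
  also have "\<dots> = (LINT s:{0<..<x - r}|lborel. F s)"
    unfolding set_lebesgue_integral_def by (auto intro!: Bochner_Integration.integral_cong simp: indicator_def)
  finally show ?thesis by simp
qed

lemma set_integrable_shift:
  fixes F :: "real \<Rightarrow> real"
  shows "set_integrable lborel {r<..<x} (\<lambda>s. F (s - r)) \<longleftrightarrow> set_integrable lborel {0<..<x - r} F"
proof -
  have "set_integrable lborel {r<..<x} (\<lambda>s. F (s - r)) \<longleftrightarrow>
      integrable lborel (\<lambda>s. indicator {r<..<x} (r + 1 * s) *\<^sub>R F (r + 1 * s - r))"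
    unfolding set_integrable_def by (rule lborel_integrable_real_affine_iff[symmetric]) simp
  also have "\<dots> \<longleftrightarrow> set_integrable lborel {0<..<x - r} F"
    unfolding set_integrable_def by (intro Bochner_Integration.integrable_cong) (auto simp: indicator_def)
  finally show ?thesis by simp
qed

lemma set_integral_scale:
  fixes F :: "real \<Rightarrow> real"
  assumes "0 < x"
  shows "(LINT r:{0<..<x}|lborel. F r) = x * (LINT t:{0<..<1}|lborel. F (x * t))"
proof -
  have "(LINT s:{0<..<x}|lborel. F s) =
      \<bar>x\<bar> *\<^sub>R (\<integral>s. indicator {0<..<x} (0 + x * s) *\<^sub>R F (0 + x * s) \<partial>lborel)"
    unfolding set_lebesgue_integral_def by (rule lborel_integral_real_affine) (use assms in simp)
  also have "(\<integral>s. indicator {0<..<x} (0 + x * s) *\<^sub>R F (0 + x * s) \<partial>lborel)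
      = (LINT t:{0<..<1}|lborel. F (x * t))"
    unfolding set_lebesgue_integral_def
    by (intro Bochner_Integration.integral_cong refl)
       (use assms in \<open>auto simp: indicator_def zero_less_mult_iff\<close>)
  finally show ?thesis using assms by simp
qed

lemma set_integrable_scale:
  fixes F :: "real \<Rightarrow> real"
  assumes "0 < x"
  shows "set_integrable lborel {0<..<1} (\<lambda>t. F (x * t)) \<longleftrightarrow> set_integrable lborel {0<..<x} F"
proof -
  have "set_integrable lborel {0<..<x} F \<longleftrightarrow>
      integrable lborel (\<lambda>s. indicator {0<..<x} (0 + x * s) *\<^sub>R F (0 + x * s))"
    unfolding set_integrable_def
    by (rule lborel_integrable_real_affine_iff[symmetric]) (use assms in simp)
  also have "\<dots> \<longleftrightarrow> set_integrable lborel {0<..<1} (\<lambda>t. F (x * t))"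
    unfolding set_integrable_def
    by (intro Bochner_Integration.integrable_cong refl)
       (use assms in \<open>auto simp: indicator_def zero_less_mult_iff\<close>)
  finally show ?thesis by simp
qed

lemma conv_commute: "conv g h x = conv h g x"
proof -
  have "conv g h x = (LINT s:{0<..<x}|lborel. (\<lambda>s. g s * h (x - s)) (x - s))"
    by (simp add: conv_def)
  also have "\<dots> = (LINT s:{0<..<x}|lborel. g s * h (x - s))"
    by (rule set_integral_reflect)
  finally show ?thesis
    by (simp add: conv_def mult.commute)
qed

lemma conv_cong:
  assumes "\<And>s. 0 < s \<Longrightarrow> s < x \<Longrightarrow> g s = g' s" "\<And>s. 0 < s \<Longrightarrow> s < x \<Longrightarrow> h s = h' s"
  shows "conv g h x = conv g' h' x"
  unfolding conv_def using assms by (intro set_lebesgue_integral_cong) auto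

lemma conv_cong_right:
  assumes "\<And>s. 0 < s \<Longrightarrow> s < x \<Longrightarrow> h s = h' s"
  shows "conv g h x = conv g h' x"
  by (rule conv_cong) (auto simp: assms)

lemma conv_one_left: "conv (\<lambda>_. 1) h x = (LINT s:{0<..<x}|lborel. h s)"
  by (simp add: conv_def)

lemma conv_one_right: "conv g (\<lambda>_. 1) x = (LINT s:{0<..<x}|lborel. g s)"
  by (simp add: conv_commute[of g] conv_one_left)

text \<open>Fubini on the triangle \<open>0 < r < s < x\<close>. As \<open>a\<close> and
  \<open>b\<close> are nonnegative, the row integral of the absolute value is
  \<open>d (x - r) * \<bar>c r\<bar>\<close>, so the single condition \<open>dc\<close> yields joint
  integrability even if \<open>c\<close> changes sign or is singular at \<open>0\<close>. The
  separate name \<open>d\<close> allows a known closed form of \<open>a * b\<close>, such as the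
  constant \<open>1\<close> of a Sonine pair.\<close>

lemma conv_assoc:
  fixes a b c d :: "real \<Rightarrow> real"
  assumes meas[measurable]: "a \<in> borel_measurable borel" "b \<in> borel_measurable borel"
      "c \<in> borel_measurable borel"
    and nonneg: "\<And>s. 0 < s \<Longrightarrow> 0 \<le> a s" "\<And>s. 0 < s \<Longrightarrow> 0 \<le> b s"
    and int: "\<And>y. 0 < y \<Longrightarrow> y < x \<Longrightarrow> set_integrable lborel {0<..<y} (\<lambda>s. a (y - s) * b s)"
    and d: "\<And>y. 0 < y \<Longrightarrow> y < x \<Longrightarrow> conv a b y = d y"
    and dc: "set_integrable lborel {0<..<x} (\<lambda>r. d (x - r) * c r)"
  shows "conv a (conv b c) x = conv d c x"
proof -
  define F where "F r s = (if 0 < r \<and> r < s \<and> s < x then a (x - s) * b (s - r) * c r else 0)" for r s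
  have Fm: "(\<lambda>(r, s). F r s) \<in> borel_measurable (lborel \<Otimes>\<^sub>M lborel)"
    unfolding F_def by measurable
  have row: "integrable lborel (F r) \<and> integral\<^sup>L lborel (F r) = indicator {0<..<x} r * (d (x - r) * c r)
      \<and> (\<integral>s. \<bar>F r s\<bar> \<partial>lborel) = \<bar>indicator {0<..<x} r * (d (x - r) * c r)\<bar>" for r
  proof (cases "0 < r \<and> r < x")
    case True
    have eq: "F r s = indicator {r<..<x} s *\<^sub>R (((\<lambda>s. a (x - r - s) * b s) (s - r)) * c r)" for s
      using True by (auto simp: F_def)
    have abs: "\<bar>F r s\<bar> = indicator {r<..<x} s *\<^sub>R (((\<lambda>s. a (x - r - s) * b s) (s - r)) * \<bar>c r\<bar>)" for s
      using True nonneg by (auto simp: F_def abs_mult indicator_def)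
    have i: "set_integrable lborel {r<..<x} (\<lambda>s. (\<lambda>s. a (x - r - s) * b s) (s - r))"
      using set_integrable_shift[of r x "\<lambda>s. a (x - r - s) * b s"] int[of "x - r"] True by auto
    have v: "(LINT s:{r<..<x}|lborel. (\<lambda>s. a (x - r - s) * b s) (s - r)) = d (x - r)"
      using set_integral_shift[of r x "\<lambda>s. a (x - r - s) * b s"] d[of "x - r"] True
      by (auto simp: conv_def)
    have d0: "0 \<le> d (x - r)"
    proof -
      have "0 \<le> conv a b (x - r)"
        unfolding conv_def set_lebesgue_integral_def using nonneg
        by (intro Bochner_Integration.integral_nonneg) (auto simp: indicator_def)
      then show ?thesis using d[of "x - r"] True by simp
    qed
    have "integrable lborel (F r)"
      using i unfolding eq set_integrable_def[symmetric] by (rule set_integrable_mult_left)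
    moreover have "integral\<^sup>L lborel (F r) = d (x - r) * c r"
      unfolding eq set_lebesgue_integral_def[symmetric] using v by simp
    moreover have "(\<integral>s. \<bar>F r s\<bar> \<partial>lborel) = d (x - r) * \<bar>c r\<bar>"
      unfolding abs set_lebesgue_integral_def[symmetric] using v by simp
    ultimately show ?thesis using True d0 by (auto simp: abs_mult)
  next
    case False
    then have "F r = (\<lambda>_. 0)" by (auto simp: F_def fun_eq_iff)
    then show ?thesis using False by auto
  qed
  have "integrable (lborel \<Otimes>\<^sub>M lborel) (\<lambda>(r, s). F r s)"
  proof (rule lborel_pair.Fubini_integrable[OF Fm])
    show "integrable lborel (\<lambda>r. \<integral>s. norm (case (r, s) of (r, s) \<Rightarrow> F r s) \<partial>lborel)"
      using row dc by (auto simp: set_integrable_def)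
    show "AE r in lborel. integrable lborel (\<lambda>s. case (r, s) of (r, s) \<Rightarrow> F r s)"
      using row by auto
  qed
  then have "(\<integral>s. (\<integral>r. F r s \<partial>lborel) \<partial>lborel) = (\<integral>r. (\<integral>s. F r s \<partial>lborel) \<partial>lborel)"
    by (rule lborel_pair.Fubini_integral)
  moreover have "(\<integral>s. F r s \<partial>lborel) = indicator {0<..<x} r *\<^sub>R (d (x - r) * c r)" for r
    using row by auto
  moreover have "(\<integral>r. F r s \<partial>lborel) = indicator {0<..<x} s *\<^sub>R (a (x - s) * conv b c s)" for s
  proof -
    have "F r s = indicator {0<..<x} s * a (x - s) * (indicator {0<..<s} r *\<^sub>R (b (s - r) * c r))" for r
      by (auto simp: F_def indicator_def)
    then show ?thesis
      by (simp add: conv_def set_lebesgue_integral_def)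
  qed
  ultimately show ?thesis
    unfolding conv_def[of a] conv_def[of d] set_lebesgue_integral_def by simp
qed

text \<open>The common shape of the tail, of the potential density and of the constant
  \<open>1\<close>: a singularity at \<open>0\<close> is allowed as long as it is integrable. On
  \<open>{..0}\<close> only Borel measurability is asked for; the two kernels of the theorem obtain
  it by extension by zero.\<close>

definition decreasing_kernel :: "(real \<Rightarrow> real) \<Rightarrow> bool" where
  "decreasing_kernel a \<longleftrightarrow> a \<in> borel_measurable borel \<and> continuous_on {0<..} a \<and>
     (\<forall>x>0. 0 \<le> a x) \<and> (\<forall>x y. 0 < x \<longrightarrow> x \<le> y \<longrightarrow> a y \<le> a x) \<and>
     (\<forall>x. set_integrable lborel {0<..<x} a)"

lemma decreasing_kernel_one: "decreasing_kernel (\<lambda>_. 1)"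
proof -
  have "integrable lborel (indicator {0<..<x} :: real \<Rightarrow> real)" for x :: real
    by (cases "0 \<le> x") auto
  then show ?thesis by (simp add: decreasing_kernel_def set_integrable_def)
qed

lemma decreasing_kernelD:
  assumes "decreasing_kernel a"
  shows "a \<in> borel_measurable borel" "continuous_on {0<..} a" "\<And>x. 0 < x \<Longrightarrow> 0 \<le> a x"
    "\<And>x y. 0 < x \<Longrightarrow> x \<le> y \<Longrightarrow> a y \<le> a x" "\<And>x. set_integrable lborel {0<..<x} a"
  using assms by (auto simp: decreasing_kernel_def)

text \<open>The singularities sit at opposite ends of \<open>(0,x)\<close>. On either side of
  \<open>x / 2\<close> one factor is away from its singularity, hence at most its value at
  \<open>x / 2\<close>, and the other factor is integrable.\<close>

lemma kernel_product_integrable: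
  assumes a: "decreasing_kernel a" and b: "decreasing_kernel b"
  shows "set_integrable lborel {0<..<x} (\<lambda>r. a r * b (x - r))"
proof (cases "0 < x")
  case True
  note [measurable] = decreasing_kernelD(1)[OF a] decreasing_kernelD(1)[OF b]
  let ?B = "\<lambda>r. b (x / 2) * a r + a (x / 2) * b (x - r)"
  have "set_integrable lborel {0<..<x} ?B"
    using decreasing_kernelD(5)[OF a] decreasing_kernelD(5)[OF b]
    by (intro set_integral_add set_integrable_mult_right impI) (auto simp: set_integrable_reflect)
  then show ?thesis
  proof (rule set_integrable_bound)
    show "set_borel_measurable lborel {0<..<x} (\<lambda>r. a r * b (x - r))"
      unfolding set_borel_measurable_def by measurable
    have "norm (a r * b (x - r)) \<le> norm (?B r)" if r: "0 < r" "r < x" for r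
    proof -
      have nn: "0 \<le> a r" "0 \<le> b (x - r)" "0 \<le> a (x / 2)" "0 \<le> b (x / 2)"
        using r True decreasing_kernelD(3)[OF a] decreasing_kernelD(3)[OF b] by auto
      consider "r \<le> x / 2" | "x / 2 \<le> r" by linarith
      then have "a r * b (x - r) \<le> ?B r"
      proof cases
        case 1
        then have "b (x - r) \<le> b (x / 2)" using True by (intro decreasing_kernelD(4)[OF b]) auto
        then have "a r * b (x - r) \<le> a r * b (x / 2)" using nn by (intro mult_left_mono)
        moreover have "0 \<le> a (x / 2) * b (x - r)" using nn by simp
        ultimately show ?thesis by (simp add: mult.commute)
      next
        case 2
        then have "a r \<le> a (x / 2)" using True by (intro decreasing_kernelD(4)[OF a]) auto
        then have "a r * b (x - r) \<le> a (x / 2) * b (x - r)" using nn by (intro mult_right_mono)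
        moreover have "0 \<le> b (x / 2) * a r" using nn by simp
        ultimately show ?thesis by simp
      qed
      then show ?thesis using nn by simp
    qed
    then show "AE r in lborel. r \<in> {0<..<x} \<longrightarrow> norm (a r * b (x - r)) \<le> norm (?B r)"
      by auto
  qed
qed (auto simp: set_integrable_def)

lemma continuous_imp_restr_measurable:
  fixes \<phi> :: "real \<Rightarrow> real"
  assumes "continuous_on A \<phi>" "A \<in> sets borel"
  shows "(\<lambda>x. indicator A x * \<phi> x) \<in> borel_measurable borel"
  using borel_measurable_continuous_on_indicator[OF assms(2,1)] by simp

lemma continuous_on_Icc_bound:
  fixes \<phi> :: "real \<Rightarrow> real"
  assumes "continuous_on {a..b} \<phi>"
  obtains M where "0 \<le> M" "\<And>x. x \<in> {a..b} \<Longrightarrow> \<bar>\<phi> x\<bar> \<le> M"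
proof -
  have "bounded (\<phi> ` {a..b})"
    using compact_continuous_image[OF assms] by (auto intro: compact_imp_bounded)
  then obtain M where "\<forall>x\<in>\<phi> ` {a..b}. norm x \<le> M" by (auto simp: bounded_iff)
  then show thesis by (intro that[of "max M 0"]) (auto intro: max.coboundedI1)
qed

lemma set_integrable_mult_bounded:
  fixes F \<phi> :: "real \<Rightarrow> real"
  assumes F: "set_integrable lborel {0<..<x} F"
    and \<phi>: "continuous_on {0..T} \<phi>" and x: "x \<le> T"
  shows "set_integrable lborel {0<..<x} (\<lambda>r. F r * \<phi> r)"
proof -
  obtain M where M: "0 \<le> M" "\<And>x. x \<in> {0..T} \<Longrightarrow> \<bar>\<phi> x\<bar> \<le> M"
    using continuous_on_Icc_bound[OF \<phi>] by blast
  have Fi: "integrable lborel (\<lambda>r. indicator {0<..<x} r * F r)"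
    using F by (simp add: set_integrable_def)
  have c: "continuous_on {0<..<x} \<phi>" using \<phi> x by (auto intro: continuous_on_subset)
  note [measurable] = borel_measurable_integrable[OF Fi] continuous_imp_restr_measurable[OF c]
  \<comment> \<open>Measurability is available only for the two functions cut off to
    \<open>(0,x)\<close>, so the indicator is carried by both factors.\<close>
  have "integrable lborel (\<lambda>r. (indicator {0<..<x} r * F r) * (indicator {0<..<x} r * \<phi> r))"
  proof (rule Bochner_Integration.integrable_bound[OF integrable_mult_right[OF Fi, of M]])
    show "(\<lambda>r. (indicator {0<..<x} r * F r) * (indicator {0<..<x} r * \<phi> r)) \<in> borel_measurable lborel"
      by simp
    show "AE r in lborel. norm ((indicator {0<..<x} r * F r) * (indicator {0<..<x} r * \<phi> r))
        \<le> norm (M * (indicator {0<..<x} r * F r))"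
      using M x
      by (intro AE_I2) (auto simp: indicator_def abs_mult mult.commute[of M] intro!: mult_left_mono)
  qed
  then show ?thesis
    unfolding set_integrable_def by (rule Bochner_Integration.integrable_cong[THEN iffD1, rotated -1])
       (auto simp: indicator_def)
qed

text \<open>For \<open>a = 1\<close> this is the convolution \<open>b * \<phi>\<close>; for
  \<open>a = m\<close>, \<open>b = k\<close> it is \<open>K_op\<close> away from \<open>0\<close>.
  One proof of linearity, of the bound and of continuity thus serves both operators.\<close>

definition kernel_integral :: "(real \<Rightarrow> real) \<Rightarrow> (real \<Rightarrow> real) \<Rightarrow> (real \<Rightarrow> real) \<Rightarrow> real \<Rightarrow> real" where
  "kernel_integral a b \<phi> x = (LINT r:{0<..<x}|lborel. a r * b (x - r) * \<phi> r)"

lemma kernel_integral_integrable: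
  assumes "decreasing_kernel a" "decreasing_kernel b" "continuous_on {0..T} \<phi>" "x \<le> T"
  shows "set_integrable lborel {0<..<x} (\<lambda>r. a r * b (x - r) * \<phi> r)"
  by (rule set_integrable_mult_bounded[OF kernel_product_integrable[OF assms(1,2)] assms(3,4)])

text \<open>After rescaling to \<open>(0,1)\<close>, monotonicity of both kernels gives a dominating function that is
  uniform for \<open>x \<ge> c\<close>.\<close>

lemma continuous_on_kernel_integral:
  assumes a: "decreasing_kernel a" and b: "decreasing_kernel b" and \<phi>: "continuous_on {0..T} \<phi>"
  shows "continuous_on {0<..T} (kernel_integral a b \<phi>)"
proof -
  obtain M where M: "0 \<le> M" "\<And>x. x \<in> {0..T} \<Longrightarrow> \<bar>\<phi> x\<bar> \<le> M"
    using continuous_on_Icc_bound[OF \<phi>] by blast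
  let ?G = "\<lambda>x t. x * (a (x * t) * b (x - x * t) * \<phi> (x * t))"
  have scaled: "kernel_integral a b \<phi> x = (LINT t:{0<..<1}|lborel. ?G x t)" if "0 < x" for x
    using set_integral_scale[OF that, of "\<lambda>r. a r * b (x - r) * \<phi> r"] by (simp add: kernel_integral_def)
  have meas: "set_integrable lborel {0<..<1} (?G x)" if "0 < x" "x \<le> T" for x
    using set_integrable_scale[OF \<open>0 < x\<close>, of "\<lambda>r. a r * b (x - r) * \<phi> r"]
      kernel_integral_integrable[OF a b \<phi> \<open>x \<le> T\<close>] by simp
  have *: "continuous_on {c..T} (kernel_integral a b \<phi>)" if c: "0 < c" for c
  proof (cases "c \<le> T")
    case True
    let ?W = "\<lambda>t. T * M * (a (c * t) * b (c - c * t))"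
    have W: "set_integrable lborel {0<..<1} ?W"
      using set_integrable_scale[OF c, of "\<lambda>r. a r * b (c - r)"] kernel_product_integrable[OF a b, of c]
      by simp
    show ?thesis
      unfolding continuous_on_sequentially o_def
    proof (intro allI ballI impI, elim conjE)
      fix X x assume X: "\<forall>n. X n \<in> {c..T}" "X \<longlonglongrightarrow> x" and x: "x \<in> {c..T}"
      have "(\<lambda>n. LINT t:{0<..<1}|lborel. ?G (X n) t) \<longlonglongrightarrow> (LINT t:{0<..<1}|lborel. ?G x t)"
        unfolding set_lebesgue_integral_def
      proof (rule integral_dominated_convergence)
        show "(\<lambda>t. indicator {0<..<1} t *\<^sub>R ?G x t) \<in> borel_measurable lborel"
          using meas[of x] x c unfolding set_integrable_def by (intro borel_measurable_integrable) simp
        show "(\<lambda>t. indicator {0<..<1} t *\<^sub>R ?G (X n) t) \<in> borel_measurable lborel" for n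
          using meas[of "X n"] X(1)[rule_format, of n] c
          unfolding set_integrable_def by (intro borel_measurable_integrable) simp
        show "integrable lborel (\<lambda>t. indicator {0<..<1} t *\<^sub>R ?W t)"
          using W by (simp add: set_integrable_def)
        show "AE t in lborel. (\<lambda>n. indicator {0<..<1} t *\<^sub>R ?G (X n) t)
            \<longlonglongrightarrow> indicator {0<..<1} t *\<^sub>R ?G x t"
        proof (intro AE_I2)
          fix t
          show "(\<lambda>n. indicator {0<..<1} t *\<^sub>R ?G (X n) t) \<longlonglongrightarrow> indicator {0<..<1} t *\<^sub>R ?G x t"
          proof (cases "t \<in> {0<..<1}")
            case True
            then have pos: "0 < y * t" "0 < y - y * t" "0 \<le> y * t" "y * t \<le> T" if "y \<in> {c..T}" for y
            proof -
              have "0 < y * t" using that c True by simp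
              moreover have "y * t < y" using that c True by simp
              ultimately show "0 < y * t" "0 < y - y * t" "0 \<le> y * t" "y * t \<le> T" using that by auto
            qed
            have "continuous_on {c..T} (\<lambda>y. ?G y t)"
              using pos
              by (intro continuous_intros continuous_on_compose2[OF decreasing_kernelD(2)[OF a]]
                  continuous_on_compose2[OF decreasing_kernelD(2)[OF b]]
                  continuous_on_compose2[OF \<phi>]) auto
            then have "(\<lambda>n. ?G (X n) t) \<longlonglongrightarrow> ?G x t"
              using X x by (auto simp: continuous_on_sequentially o_def)
            then show ?thesis by (rule tendsto_scaleR[OF tendsto_const])
          qed simp
        qed
        show "AE t in lborel. norm (indicator {0<..<1} t *\<^sub>R ?G (X n) t)
            \<le> indicator {0<..<1} t *\<^sub>R ?W t" for n
        proof (intro AE_I2)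
          fix t :: real
          have "\<bar>?G (X n) t\<bar> \<le> ?W t" if t: "0 < t" "t < 1"
          proof -
            let ?y = "X n"
            have y: "c \<le> ?y" "?y \<le> T" using X by auto
            have p: "0 < c * t" "c * t \<le> ?y * t" "0 < c - c * t" "c - c * t \<le> ?y - ?y * t" "?y * t \<le> T"
            proof -
              show "0 < c * t" "c * t \<le> ?y * t" using c t y by auto
              have "0 < c * (1 - t)" "c * (1 - t) \<le> ?y * (1 - t)" using c t y by auto
              then show "0 < c - c * t" "c - c * t \<le> ?y - ?y * t" by (auto simp: algebra_simps)
              have "?y * t \<le> ?y * 1" using c t y by (intro mult_left_mono) auto
              then show "?y * t \<le> T" using y by simp
            qed
            have "\<bar>\<phi> (?y * t)\<bar> \<le> M" using p by (intro M) auto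
            moreover have "a (?y * t) \<le> a (c * t)" "0 \<le> a (?y * t)" "0 \<le> a (c * t)"
              using decreasing_kernelD(3,4)[OF a] p by auto
            moreover have "b (?y - ?y * t) \<le> b (c - c * t)" "0 \<le> b (?y - ?y * t)" "0 \<le> b (c - c * t)"
              using decreasing_kernelD(3,4)[OF b] p(3,4) by (auto intro: less_le_trans)
            ultimately have "?y * (a (?y * t) * b (?y - ?y * t) * \<bar>\<phi> (?y * t)\<bar>)
                \<le> T * (a (c * t) * b (c - c * t) * M)"
              using y c M by (intro mult_mono mult_nonneg_nonneg) auto
            moreover have "\<bar>?G ?y t\<bar> = ?y * (a (?y * t) * b (?y - ?y * t) * \<bar>\<phi> (?y * t)\<bar>)"
              using y c \<open>0 \<le> a (?y * t)\<close> \<open>0 \<le> b (?y - ?y * t)\<close> by (simp add: abs_mult)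
            ultimately show ?thesis by (simp add: mult_ac)
          qed
          then show "norm (indicator {0<..<1} t *\<^sub>R ?G (X n) t) \<le> indicator {0<..<1} t *\<^sub>R ?W t"
            by (auto simp: indicator_def)
        qed
      qed
      moreover have "0 < X n" for n using X c by (auto intro: less_le_trans)
      ultimately show "(\<lambda>n. kernel_integral a b \<phi> (X n)) \<longlonglongrightarrow> kernel_integral a b \<phi> x"
        using scaled c x by simp
    qed
  qed auto
  show ?thesis
    unfolding continuous_on_eq_continuous_within
  proof
    fix x assume x: "x \<in> {0<..T}"
    have "at x within {x / 2..T} = at x within {0<..T}"
      using x by (intro at_within_nhd[of _ "{x / 2<..}"]) auto
    then show "continuous (at x within {0<..T}) (kernel_integral a b \<phi>)"
      using *[of "x / 2"] x by (auto simp: continuous_on_eq_continuous_within dest!: bspec[of _ _ x] simp: continuous_within)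
  qed
qed

section \<open>Primitives on a half-open interval\<close>

lemma tendsto_primitive_at_0:
  fixes v :: "real \<Rightarrow> real"
  assumes "0 < T" and v: "set_integrable lborel {0<..<T} v"
  shows "((\<lambda>x. LINT s:{0<..<x}|lborel. v s) \<longlongrightarrow> 0) (at_right 0)"
proof -
  have "((\<lambda>x. LINT s:{0<..<x}|lborel. v s) \<longlongrightarrow> 0) (at 0 within {0<..T})"
    unfolding tendsto_at_iff_sequentially o_def
  proof (intro allI impI)
    fix X :: "nat \<Rightarrow> real" assume X: "\<forall>n. X n \<in> {0<..T} - {0}" "X \<longlonglongrightarrow> 0"
    have "(\<lambda>n. LINT s:{0<..<X n}|lborel. v s) \<longlonglongrightarrow> (\<integral>s. 0 \<partial>(lborel :: real measure))"
      unfolding set_lebesgue_integral_def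
    proof (rule integral_dominated_convergence)
      show "(\<lambda>s. indicator {0<..<X n} s *\<^sub>R v s) \<in> borel_measurable lborel" for n
      proof -
        have "set_integrable lborel {0<..<X n} v"
          using X(1)[rule_format, of n] by (intro set_integrable_subset[OF v]) auto
        then show ?thesis unfolding set_integrable_def by (rule borel_measurable_integrable)
      qed
      show "integrable lborel (\<lambda>s. \<bar>indicator {0<..<T} s *\<^sub>R v s\<bar>)"
        using v by (simp add: set_integrable_def)
      show "AE s in lborel. norm (indicator {0<..<X n} s *\<^sub>R v s) \<le> \<bar>indicator {0<..<T} s *\<^sub>R v s\<bar>" for n
        using X(1)[rule_format, of n] by (auto simp: indicator_def)
      show "AE s in lborel. (\<lambda>n. indicator {0<..<X n} s *\<^sub>R v s) \<longlonglongrightarrow> 0"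
      proof (intro AE_I2)
        fix s :: real
        have "eventually (\<lambda>n. indicator {0<..<X n} s *\<^sub>R v s = 0) sequentially"
        proof (cases "0 < s")
          case True
          then have "eventually (\<lambda>n. X n < s) sequentially" using X(2) by (auto simp: order_tendsto_iff)
          then show ?thesis by eventually_elim auto
        qed auto
        then show "(\<lambda>n. indicator {0<..<X n} s *\<^sub>R v s) \<longlonglongrightarrow> 0" by (rule tendsto_eventually)
      qed
    qed simp
    then show "(\<lambda>n. LINT s:{0<..<X n}|lborel. v s) \<longlonglongrightarrow> 0" by simp
  qed
  moreover have "at 0 within {0<..T} = at_right (0::real)"
    using \<open>0 < T\<close> by (intro at_within_nhd[of _ "{..<T}"]) auto
  ultimately show ?thesis by simp
qed

text \<open>Since \<open>v\<close> may be singular at \<open>0\<close>, the fundamental theorem is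
  applied only on \<open>[x / 2, T]\<close>; the integral over \<open>(0, x / 2]\<close> is a
  constant that drops out.\<close>

lemma primitive_has_derivative:
  fixes v :: "real \<Rightarrow> real"
  assumes v: "continuous_on {0<..T} v" "set_integrable lborel {0<..<T} v" and x: "x \<in> {0<..T}"
  shows "((\<lambda>x. LINT s:{0<..<x}|lborel. v s) has_real_derivative v x) (at x within {0<..T})"
proof -
  define c where "c = x / 2"
  have c: "0 < c" "c < x" "c \<le> T" using x by (auto simp: c_def)
  have split: "(LINT s:{0<..<u}|lborel. v s) = (LINT s:{0<..c}|lborel. v s) + (LBINT s=c..u. v s)"
    if u: "u \<in> {c..T}" for u
  proof (cases "c = u")
    case True
    \<comment> \<open>The two sets differ by the single point \<open>u\<close>.\<close>
    have "(LINT s:{0<..<u}|lborel. v s) = (LINT s:{0<..c}|lborel. v s)"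
      unfolding set_lebesgue_integral_def
    proof (rule integral_cong_AE)
      show "AE s in lborel. indicator {0<..<u} s *\<^sub>R v s = indicator {0<..c} s *\<^sub>R v s"
        using AE_lborel_singleton[of u] by eventually_elim (auto simp: indicator_def True)
      show "(\<lambda>s. indicator {0<..<u} s *\<^sub>R v s) \<in> borel_measurable lborel"
           "(\<lambda>s. indicator {0<..c} s *\<^sub>R v s) \<in> borel_measurable lborel"
        using u c True
        by (auto intro!: continuous_imp_restr_measurable continuous_on_subset[OF v(1)])
    qed
    then show ?thesis using True by simp
  next
    case False
    then have cu: "c < u" using u by auto
    have "{0<..<u} = {0<..c} \<union> {c<..<u}" using cu c by auto
    moreover have "(LINT s:{0<..c} \<union> {c<..<u}|lborel. v s)
        = (LINT s:{0<..c}|lborel. v s) + (LINT s:{c<..<u}|lborel. v s)"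
      using u c cu by (intro set_integral_Un set_integrable_subset[OF v(2)]) auto
    ultimately show ?thesis using cu by (simp add: interval_integral_Ioo)
  qed
  have "((\<lambda>u. LBINT s=c..u. v s) has_vector_derivative v x) (at x within {c..T})"
    using c x v(1) by (intro interval_integral_FTC2) (auto intro: continuous_on_subset)
  then have "((\<lambda>u. (LINT s:{0<..c}|lborel. v s) + (LBINT s=c..u. v s)) has_real_derivative v x)
      (at x within {c..T})"
    by (auto simp: has_real_derivative_iff_has_vector_derivative intro!: derivative_eq_intros)
  then have "((\<lambda>x. LINT s:{0<..<x}|lborel. v s) has_real_derivative v x) (at x within {c..T})"
    by (rule has_field_derivative_transform_within[of _ _ _ _ 1]) (use split x c in auto)
  moreover have "at x within {c..T} = at x within {0<..T}"
    using x c by (intro at_within_nhd[of _ "{c<..}"]) auto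
  ultimately show ?thesis by simp
qed

text \<open>Makes derivatives within \<open>(0,T]\<close> unique, the endpoint \<open>T\<close>
  included, so that the \<open>vector_derivative\<close> in \<open>D_R\<close> can be
  evaluated.\<close>

lemma at_within_Ioc_neq_bot:
  fixes x T :: real
  assumes "x \<in> {0<..T}"
  shows "at x within {0<..T} \<noteq> bot"
proof -
  have "x islimpt {0<..T}" using assms by simp
  then show ?thesis by (simp add: trivial_limit_within)
qed

text \<open>The difference to the primitive of \<open>v\<close> is constant on the interval. Being
  \<open>C1_on\<close> says nothing about \<open>0\<close>, so the constant has to be read off from
  the right-hand limit.\<close>

lemma derivative_eq_primitive:
  fixes u v :: "real \<Rightarrow> real"
  assumes "0 < T"
    and v: "continuous_on {0<..T} v" "set_integrable lborel {0<..<T} v"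
    and u: "\<And>x. x \<in> {0<..T} \<Longrightarrow> (u has_real_derivative v x) (at x within {0<..T})"
    and u0: "(u \<longlongrightarrow> 0) (at_right 0)" and x: "x \<in> {0<..T}"
  shows "u x = (LINT s:{0<..<x}|lborel. v s)"
proof -
  let ?V = "\<lambda>x. LINT s:{0<..<x}|lborel. v s"
  have "((\<lambda>x. u x - ?V x) has_real_derivative 0) (at x within {0<..T})" if "x \<in> {0<..T}" for x
    using DERIV_diff[OF u[OF that] primitive_has_derivative[OF v that]] by simp
  then have "\<exists>c. \<forall>x\<in>{0<..T}. u x - ?V x = c"
    by (intro has_field_derivative_zero_constant) auto
  then obtain c where c: "\<And>x. x \<in> {0<..T} \<Longrightarrow> u x - ?V x = c" by blast
  have "((\<lambda>x. u x - ?V x) \<longlongrightarrow> 0 - 0) (at_right 0)"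
    by (intro tendsto_diff u0 tendsto_primitive_at_0[OF \<open>0 < T\<close> v(2)])
  moreover have "eventually (\<lambda>x. u x - ?V x = c) (at_right 0)"
    using eventually_at_right_less[of 0] eventually_at_right_real[OF \<open>0 < T\<close>]
    by eventually_elim (auto intro!: c)
  ultimately have "((\<lambda>x. c) \<longlongrightarrow> 0) (at_right (0::real))"
    using tendsto_cong[of "\<lambda>x. u x - ?V x" "\<lambda>_. c" "at_right 0" 0] by simp
  then have "c = 0" by (simp add: tendsto_const_iff)
  then show ?thesis using c[OF x] by simp
qed

section \<open>Neumann series\<close>

text \<open>A contraction in a weighted supremum norm, stated pointwise because the weight
  \<open>E\<close> may vanish, as \<open>\<kappa>\<close> does at \<open>0\<close>. It is used
  twice: for \<open>K_op\<close> with \<open>E = \<kappa> \<beta>\<close>, and for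
  \<open>\<lambda> I_Ce\<close> with an exponential weight.\<close>

locale dominated_operator =
  fixes T :: real and L :: "(real \<Rightarrow> real) \<Rightarrow> real \<Rightarrow> real" and E :: "real \<Rightarrow> real" and \<rho> :: real
  assumes lin: "\<And>\<phi> \<psi> c x. continuous_on {0..T} \<phi> \<Longrightarrow> continuous_on {0..T} \<psi> \<Longrightarrow> x \<in> {0..T} \<Longrightarrow>
      L (\<lambda>x. \<phi> x + c * \<psi> x) x = L \<phi> x + c * L \<psi> x"
    and cont: "\<And>\<phi>. continuous_on {0..T} \<phi> \<Longrightarrow> continuous_on {0..T} (L \<phi>)"
    and dom: "\<And>\<phi> N x. continuous_on {0..T} \<phi> \<Longrightarrow> (\<And>x. x \<in> {0..T} \<Longrightarrow> \<bar>\<phi> x\<bar> \<le> N * E x) \<Longrightarrow>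
      0 \<le> N \<Longrightarrow> x \<in> {0..T} \<Longrightarrow> \<bar>L \<phi> x\<bar> \<le> \<rho> * N * E x"
    and E_cont: "continuous_on {0..T} E"
    and E_nonneg: "\<And>x. x \<in> {0..T} \<Longrightarrow> 0 \<le> E x"
    and rho: "0 \<le> \<rho>" "\<rho> < 1"
begin

lemma iterate_continuous: "continuous_on {0..T} \<phi> \<Longrightarrow> continuous_on {0..T} ((L ^^ n) \<phi>)"
  by (induction n) (auto intro: cont)

lemma iterate_bound:
  assumes "continuous_on {0..T} \<phi>" "\<And>x. x \<in> {0..T} \<Longrightarrow> \<bar>\<phi> x\<bar> \<le> N * E x" "0 \<le> N" "x \<in> {0..T}"
  shows "\<bar>(L ^^ n) \<phi> x\<bar> \<le> \<rho> ^ n * N * E x"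
  using assms(4)
proof (induction n arbitrary: x)
  case (Suc n)
  have "\<bar>L ((L ^^ n) \<phi>) x\<bar> \<le> \<rho> * (\<rho> ^ n * N) * E x"
    using Suc assms(3) rho by (intro dom iterate_continuous assms(1)) auto
  then show ?case by (simp add: mult_ac)
qed (use assms in simp)

lemma zero: "x \<in> {0..T} \<Longrightarrow> L (\<lambda>_. 0) x = 0"
  using dom[of "\<lambda>_. 0" 0 x] by simp

text \<open>\<open>L\<close> acts on total functions, but its values on \<open>[0,T]\<close> depend
  only on those of the argument on \<open>[0,T]\<close>: \<open>dom\<close> applies to the
  difference with \<open>N = 0\<close>.\<close>

lemma cong:
  assumes "continuous_on {0..T} \<phi>" "continuous_on {0..T} \<psi>" "\<And>x. x \<in> {0..T} \<Longrightarrow> \<phi> x = \<psi> x"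
    "x \<in> {0..T}"
  shows "L \<phi> x = L \<psi> x"
proof -
  have "\<bar>L (\<lambda>x. \<phi> x + (-1) * \<psi> x) x\<bar> \<le> \<rho> * 0 * E x"
    using assms by (intro dom continuous_intros) auto
  then show ?thesis using lin[OF assms(1,2,4), of "-1"] by simp
qed

lemma sum_iterates:
  assumes "continuous_on {0..T} h" "x \<in> {0..T}"
  shows "L (\<lambda>x. \<Sum>i<n. (L ^^ i) h x) x = (\<Sum>i<n. (L ^^ Suc i) h x)"
proof (induction n)
  case (Suc n)
  have "L (\<lambda>x. (\<Sum>i<n. (L ^^ i) h x) + 1 * (L ^^ n) h x) x
      = L (\<lambda>x. \<Sum>i<n. (L ^^ i) h x) x + 1 * L ((L ^^ n) h) x"
    using assms by (intro lin continuous_intros iterate_continuous) auto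
  then show ?case using Suc by simp
qed (use assms in \<open>simp add: zero\<close>)

text \<open>Uniqueness only among functions dominated by a multiple of \<open>E\<close>. For an
  exponential weight these are all continuous functions; for a weight that vanishes at
  \<open>0\<close> they are not.\<close>

lemma fixed_point_zero:
  assumes "continuous_on {0..T} \<phi>" "\<And>x. x \<in> {0..T} \<Longrightarrow> \<bar>\<phi> x\<bar> \<le> N * E x" "0 \<le> N"
    and fixpt: "\<And>x. x \<in> {0..T} \<Longrightarrow> \<phi> x = L \<phi> x" and x: "x \<in> {0..T}"
  shows "\<phi> x = 0"
proof -
  have "\<bar>\<phi> x\<bar> \<le> \<rho> ^ n * N * E x" if "x \<in> {0..T}" for n x
    using that
  proof (induction n arbitrary: x)
    case (Suc n)
    have "\<bar>L \<phi> x\<bar> \<le> \<rho> * (\<rho> ^ n * N) * E x"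
      using Suc rho assms(1,3) by (intro dom) auto
    then show ?case using fixpt[OF Suc.prems] by (simp add: mult_ac)
  qed (use assms(2) in simp)
  then have "\<And>n. \<bar>\<phi> x\<bar> \<le> \<rho> ^ n * N * E x" using x by blast
  moreover have "(\<lambda>n. \<rho> ^ n * N * E x) \<longlonglongrightarrow> 0 * N * E x"
    using rho by (intro tendsto_mult tendsto_const LIMSEQ_power_zero) auto
  ultimately have "\<bar>\<phi> x\<bar> \<le> 0 * N * E x" by (intro LIMSEQ_le_const) auto
  then show ?thesis by simp
qed

context
  fixes h :: "real \<Rightarrow> real" and N :: real
  assumes h: "continuous_on {0..T} h" and hN: "\<And>x. x \<in> {0..T} \<Longrightarrow> \<bar>h x\<bar> \<le> N * E x" and N: "0 \<le> N"
begin

lemma neumann_summable: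
  assumes "x \<in> {0..T}"
  shows "summable (\<lambda>n. (L ^^ n) h x)"
proof (rule summable_comparison_test')
  show "summable (\<lambda>n. \<rho> ^ n * N * E x)"
    using rho by (intro summable_mult2 summable_geometric) auto
  show "norm ((L ^^ n) h x) \<le> \<rho> ^ n * N * E x" if "0 \<le> n" for n
    using iterate_bound[OF h hN N assms] by simp
qed

text \<open>The geometric remainder is expressed again as a multiple of \<open>E\<close>, because
  this is the only form of smallness that \<open>L\<close> is known to respect.\<close>

lemma neumann_tail:
  assumes x: "x \<in> {0..T}"
  shows "\<bar>(\<Sum>i. (L ^^ i) h x) - (\<Sum>i<n. (L ^^ i) h x)\<bar> \<le> \<rho> ^ n * (N / (1 - \<rho>)) * E x"
proof -
  have s: "summable (\<lambda>i. \<rho> ^ (i + n) * N * E x)"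
    using rho by (intro summable_mult2) (auto simp: power_add intro!: summable_mult2 summable_geometric)
  have "\<bar>(L ^^ (i + n)) h x\<bar> \<le> \<rho> ^ (i + n) * N * E x" for i
    by (rule iterate_bound[OF h hN N x])
  then have "\<bar>\<Sum>i. (L ^^ (i + n)) h x\<bar> \<le> (\<Sum>i. \<rho> ^ (i + n) * N * E x)"
    using norm_suminf_le[OF _ s, of "\<lambda>i. (L ^^ (i + n)) h x"] by simp
  also have "\<dots> = \<rho> ^ n * (N / (1 - \<rho>)) * E x"
  proof -
    have "(\<lambda>i. \<rho> ^ i * (\<rho> ^ n * N * E x)) sums (1 / (1 - \<rho>) * (\<rho> ^ n * N * E x))"
      using rho by (intro sums_mult2 geometric_sums) auto
    then show ?thesis by (simp add: sums_iff power_add mult_ac)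
  qed
  finally show ?thesis
    using suminf_minus_initial_segment[OF neumann_summable[OF x], of n] by simp
qed

lemma neumann_continuous: "continuous_on {0..T} (\<lambda>x. \<Sum>i. (L ^^ i) h x)"
proof -
  obtain B where B: "\<And>x. x \<in> {0..T} \<Longrightarrow> \<bar>E x\<bar> \<le> B"
    using continuous_on_Icc_bound[OF E_cont] by blast
  have "uniform_limit {0..T} (\<lambda>n x. \<Sum>i<n. (L ^^ i) h x) (\<lambda>x. \<Sum>i. (L ^^ i) h x) sequentially"
  proof (rule Weierstrass_m_test)
    show "norm ((L ^^ n) h x) \<le> \<rho> ^ n * N * B" if "x \<in> {0..T}" for n x
      using iterate_bound[OF h hN N that, of n] mult_left_mono[OF order_trans[OF abs_ge_self B[OF that]], of "\<rho> ^ n * N"] N rho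
      by simp
    show "summable (\<lambda>n. \<rho> ^ n * N * B)"
      using rho by (intro summable_mult2 summable_geometric) auto
  qed
  then show ?thesis
    by (rule uniform_limit_theorem[rotated])
       (auto intro!: always_eventually continuous_intros iterate_continuous h)
qed

lemma neumann_bound:
  "x \<in> {0..T} \<Longrightarrow> \<bar>\<Sum>i. (L ^^ i) h x\<bar> \<le> N / (1 - \<rho>) * E x"
  using neumann_tail[of x 0] by simp

text \<open>Pointwise convergence of the partial sums would not suffice to interchange
  \<open>L\<close> with the series. The remainder bound fed into \<open>dom\<close> gives
  convergence of \<open>L\<close> along the partial sums, and these images are the partial sums
  shifted by one.\<close>

lemma neumann_equation:
  assumes x: "x \<in> {0..T}"
  shows "(\<Sum>i. (L ^^ i) h x) = h x + L (\<lambda>x. \<Sum>i. (L ^^ i) h x) x"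
proof -
  let ?w = "\<lambda>x. \<Sum>i. (L ^^ i) h x" and ?S = "\<lambda>n x. \<Sum>i<n. (L ^^ i) h x"
  have Sc: "continuous_on {0..T} (?S n)" for n
    by (intro continuous_intros iterate_continuous h)
  have "\<bar>L ?w x - L (?S n) x\<bar> \<le> \<rho> ^ n * (\<rho> * (N / (1 - \<rho>)) * E x)" for n
  proof -
    have "\<bar>L (\<lambda>x. ?w x + (-1) * ?S n x) x\<bar> \<le> \<rho> * (\<rho> ^ n * (N / (1 - \<rho>))) * E x"
    proof (rule dom[OF _ _ _ x])
      show "continuous_on {0..T} (\<lambda>x. ?w x + (-1) * ?S n x)"
        by (rule continuous_on_add[OF neumann_continuous continuous_on_mult_left[OF Sc]])
      show "\<bar>?w y + (-1) * ?S n y\<bar> \<le> \<rho> ^ n * (N / (1 - \<rho>)) * E y" if "y \<in> {0..T}" for y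
        using neumann_tail[OF that, of n] by simp
      show "0 \<le> \<rho> ^ n * (N / (1 - \<rho>))" using rho N by simp
    qed
    moreover have "L (\<lambda>x. ?w x + (-1) * ?S n x) x = L ?w x + (-1) * L (?S n) x"
      by (rule lin[OF neumann_continuous Sc x])
    ultimately show ?thesis by (simp add: mult.assoc mult.left_commute[of \<rho>])
  qed
  then have "\<forall>\<^sub>F n in sequentially. norm (L ?w x - L (?S n) x) \<le> \<rho> ^ n * (\<rho> * (N / (1 - \<rho>)) * E x)"
    unfolding real_norm_def by (rule always_eventually[OF allI])
  moreover have "(\<lambda>n. \<rho> ^ n * (\<rho> * (N / (1 - \<rho>)) * E x)) \<longlonglongrightarrow> 0"
    using rho by (intro tendsto_mult_left_zero LIMSEQ_power_zero) auto
  ultimately have d: "(\<lambda>n. L ?w x - L (?S n) x) \<longlonglongrightarrow> 0"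
    by (rule Lim_null_comparison)
  have "(\<lambda>n. L (?S n) x) \<longlonglongrightarrow> L ?w x"
    using tendsto_diff[OF tendsto_const[of "L ?w x"] d] by simp
  moreover have "(\<lambda>n. L (?S n) x) \<longlonglongrightarrow> (\<Sum>i. (L ^^ Suc i) h x)"
    unfolding sum_iterates[OF h x]
    by (rule summable_LIMSEQ[OF iffD2[OF summable_Suc_iff neumann_summable[OF x]]])
  ultimately have "L ?w x = (\<Sum>i. (L ^^ Suc i) h x)"
    by (rule LIMSEQ_unique)
  moreover have "(\<Sum>i. (L ^^ Suc i) h x) = ?w x - (L ^^ 0) h x"
    by (rule suminf_split_head[OF neumann_summable[OF x]])
  moreover have "(L ^^ 0) h x = h x" by simp
  ultimately show ?thesis by linarith
qed

end

end

section \<open>Sonine kernels\<close>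

lemma kernel_integral_lin:
  assumes "decreasing_kernel a" "decreasing_kernel b" "continuous_on {0..T} \<phi>" "continuous_on {0..T} \<psi>"
    "x \<le> T"
  shows "kernel_integral a b (\<lambda>x. \<phi> x + c * \<psi> x) x = kernel_integral a b \<phi> x + c * kernel_integral a b \<psi> x"
proof -
  note i = kernel_integral_integrable[OF assms(1,2,3,5)] kernel_integral_integrable[OF assms(1,2,4,5)]
  have "kernel_integral a b (\<lambda>x. \<phi> x + c * \<psi> x) x
     = (LINT r:{0<..<x}|lborel. a r * b (x - r) * \<phi> r + c * (a r * b (x - r) * \<psi> r))"
    unfolding kernel_integral_def by (simp add: algebra_simps)
  also have "\<dots> = kernel_integral a b \<phi> x + c * kernel_integral a b \<psi> x"
    unfolding kernel_integral_def using i by simp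
  finally show ?thesis .
qed

lemma kernel_integral_bound:
  assumes "decreasing_kernel a" "decreasing_kernel b" "continuous_on {0..T} \<phi>" "x \<le> T"
    and F: "set_integrable lborel {0<..<x} F"
    and le: "\<And>r. 0 < r \<Longrightarrow> r < x \<Longrightarrow> a r * b (x - r) * \<bar>\<phi> r\<bar> \<le> F r"
  shows "\<bar>kernel_integral a b \<phi> x\<bar> \<le> (LINT r:{0<..<x}|lborel. F r)"
proof -
  note i = kernel_integral_integrable[OF assms(1-4)]
  have "\<bar>kernel_integral a b \<phi> x\<bar> \<le> (LINT r:{0<..<x}|lborel. \<bar>a r * b (x - r) * \<phi> r\<bar>)"
    unfolding kernel_integral_def set_lebesgue_integral_def
    using integral_abs_bound[of lborel "\<lambda>r. indicator {0<..<x} r *\<^sub>R (a r * b (x - r) * \<phi> r)"]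
    by (simp add: abs_mult)
  also have "\<dots> \<le> (LINT r:{0<..<x}|lborel. F r)"
    using le decreasing_kernelD(3)[OF assms(1)] decreasing_kernelD(3)[OF assms(2)]
    by (intro set_integral_mono set_integrable_abs i F) (auto simp: abs_mult)
  finally show ?thesis .
qed

lemma continuous_on_Icc_from_Ioc:
  fixes F :: "real \<Rightarrow> real"
  assumes "continuous_on {0<..T} F" "(F \<longlongrightarrow> F 0) (at_right 0)" "0 < T"
  shows "continuous_on {0..T} F"
  unfolding continuous_on_eq_continuous_within
proof
  fix x assume x: "x \<in> {0..T}"
  show "continuous (at x within {0..T}) F"
  proof (cases "x = 0")
    case True
    then show ?thesis using assms by (simp add: continuous_within at_within_Icc_at_right)
  next
    case False
    then have "at x within {0..T} = at x within {0<..T}"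
      using x by (intro at_within_nhd[of _ "{0<..}"]) auto
    then show ?thesis using False x assms(1) by (simp add: continuous_on_eq_continuous_within)
  qed
qed

text \<open>Here \<open>q\<close> is a bound on the whole of \<open>(0,T]\<close> and not the limit
  at \<open>0\<close>. The assumption \<open>laplace_k\<close> is the form in which
  \<open>1/f(\<beta>) \<rightarrow> 0\<close> enters; its uniformity in \<open>x\<close> comes from
  \<open>k\<close> being nonnegative.\<close>

locale sonine_kernel =
  fixes m k :: "real \<Rightarrow> real" and T q :: real
  assumes m: "decreasing_kernel m" and k: "decreasing_kernel k"
    and sonine: "\<And>x. 0 < x \<Longrightarrow> conv m k x = 1"
    and T: "0 < T"
    and q_less: "q < 1" and q: "\<And>x. x \<in> {0<..T} \<Longrightarrow> m x * conv k (\<lambda>_. 1) x \<le> q"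
    and laplace_k: "\<And>e. 0 < e \<Longrightarrow> \<exists>\<beta>\<ge>0. \<forall>x>0. (LINT s:{0<..<x}|lborel. exp (- \<beta> * s) * k s) \<le> e"
begin

abbreviation "\<kappa> \<beta> \<equiv> conv k (\<lambda>s. exp (\<beta> * s))"

lemma conv_k_eq: "conv k g x = kernel_integral (\<lambda>_. 1) k g x"
  by (simp add: conv_def kernel_integral_def)

lemma K_op_eq: "x \<noteq> 0 \<Longrightarrow> K_op m k \<phi> x = kernel_integral m k \<phi> x"
  by (simp add: K_op_def kernel_integral_def)

lemma conv_k_0 [simp]: "conv k g 0 = 0"
  by (simp add: conv_def set_lebesgue_integral_def)

lemma conv_k_nonneg: "(\<And>s. 0 < s \<Longrightarrow> s < x \<Longrightarrow> 0 \<le> g s) \<Longrightarrow> 0 \<le> conv k g x"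
  unfolding conv_def set_lebesgue_integral_def using decreasing_kernelD(3)[OF k]
  by (intro Bochner_Integration.integral_nonneg) (auto simp: indicator_def)

lemma q_nonneg: "0 \<le> q"
proof -
  have "0 \<le> m T * conv k (\<lambda>_. 1) T"
    using decreasing_kernelD(3)[OF m T] by (intro mult_nonneg_nonneg conv_k_nonneg) auto
  then show ?thesis using q[of T] T by auto
qed

lemma k_reflect_integrable: "set_integrable lborel {0<..<x} (\<lambda>r. k (x - r))"
  using decreasing_kernelD(5)[OF k] by (simp add: set_integrable_reflect)

lemma conv_k_integrable:
  assumes "continuous_on {0..T} g" "x \<le> T"
  shows "set_integrable lborel {0<..<x} (\<lambda>r. k (x - r) * g r)"
  by (rule set_integrable_mult_bounded[OF k_reflect_integrable assms])

lemma conv_k_bound: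
  assumes "continuous_on {0..T} g" "continuous_on {0..T} h" "x \<le> T"
    "\<And>r. r \<in> {0..T} \<Longrightarrow> \<bar>g r\<bar> \<le> N * h r"
  shows "\<bar>conv k g x\<bar> \<le> N * conv k h x"
proof -
  have "\<bar>conv k g x\<bar> \<le> (LINT r:{0<..<x}|lborel. N * (k (x - r) * h r))"
    unfolding conv_k_eq
  proof (rule kernel_integral_bound[OF decreasing_kernel_one k assms(1,3)])
    show "set_integrable lborel {0<..<x} (\<lambda>r. N * (k (x - r) * h r))"
      using conv_k_integrable[OF assms(2,3)] by simp
    show "1 * k (x - r) * \<bar>g r\<bar> \<le> N * (k (x - r) * h r)" if "0 < r" "r < x" for r
      using mult_left_mono[OF assms(4)[of r], of "k (x - r)"] decreasing_kernelD(3)[OF k, of "x - r"] that assms(3)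
      by (simp add: mult_ac)
  qed
  then show ?thesis by (simp add: conv_def)
qed

lemma conv_k_lin:
  assumes "continuous_on {0..T} g" "continuous_on {0..T} h" "x \<le> T"
  shows "conv k (\<lambda>x. g x + c * h x) x = conv k g x + c * conv k h x"
  unfolding conv_k_eq by (rule kernel_integral_lin[OF decreasing_kernel_one k assms])

text \<open>Used for both kernels: with \<open>k\<close> it gives continuity of \<open>k * g\<close>
  at \<open>0\<close>, with \<open>m\<close> it fixes the constant of integration when a solution is
  integrated.\<close>

lemma kernel_conv_tendsto_0:
  assumes a: "decreasing_kernel a" and g: "continuous_on {0..T} g"
  shows "(conv a g \<longlongrightarrow> 0) (at_right 0)"
proof -
  obtain M where M: "\<And>x. x \<in> {0..T} \<Longrightarrow> \<bar>g x\<bar> \<le> M"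
    using continuous_on_Icc_bound[OF g] by blast
  have *: "\<bar>conv a g x\<bar> \<le> M * (LINT s:{0<..<x}|lborel. a s)" if x: "0 < x" "x \<le> T" for x
  proof -
    have "\<bar>kernel_integral (\<lambda>_. 1) a g x\<bar> \<le> (LINT r:{0<..<x}|lborel. M * a (x - r))"
    proof (rule kernel_integral_bound[OF decreasing_kernel_one a g x(2)])
      show "set_integrable lborel {0<..<x} (\<lambda>r. M * a (x - r))"
        using decreasing_kernelD(5)[OF a] by (simp add: set_integrable_reflect)
      show "1 * a (x - r) * \<bar>g r\<bar> \<le> M * a (x - r)" if "0 < r" "r < x" for r
        using mult_left_mono[OF M[of r], of "a (x - r)"] decreasing_kernelD(3)[OF a, of "x - r"] that x
        by (simp add: mult_ac)
    qed
    then show ?thesis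
      using set_integral_reflect[of x a] by (simp add: conv_def kernel_integral_def)
  qed
  have "eventually (\<lambda>x. norm (conv a g x) \<le> M * (LINT s:{0<..<x}|lborel. a s)) (at_right 0)"
    using eventually_at_right_real[OF T] by eventually_elim (use * in auto)
  moreover have "((\<lambda>x. M * (LINT s:{0<..<x}|lborel. a s)) \<longlongrightarrow> 0) (at_right 0)"
    by (rule tendsto_mult_right_zero[OF tendsto_primitive_at_0[OF T decreasing_kernelD(5)[OF a]]])
  ultimately show ?thesis
    by (rule Lim_null_comparison)
qed

lemma conv_k_continuous:
  assumes g: "continuous_on {0..T} g"
  shows "continuous_on {0..T} (conv k g)"
proof (rule continuous_on_Icc_from_Ioc[OF _ _ T])
  show "continuous_on {0<..T} (conv k g)"
    using continuous_on_kernel_integral[OF decreasing_kernel_one k g]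
    by (simp add: conv_k_eq[abs_def])
  show "(conv k g \<longlongrightarrow> conv k g 0) (at_right 0)"
    using kernel_conv_tendsto_0[OF k g] by simp
qed

lemma I_R_eq: "I_R k = conv k"
  by (simp add: I_R_def fun_eq_iff)

section \<open>The averaging operator \<open>K_op\<close>\<close>

lemma K_op_lin:
  assumes "continuous_on {0..T} g" "continuous_on {0..T} h" "x \<le> T"
  shows "K_op m k (\<lambda>x. g x + c * h x) x = K_op m k g x + c * K_op m k h x"
proof (cases "x = 0")
  case False
  then show ?thesis using kernel_integral_lin[OF m k assms] by (simp add: K_op_eq)
qed (simp add: K_op_def)

lemma kernel_integral_const:
  assumes "0 < x"
  shows "(LINT r:{0<..<x}|lborel. m r * k (x - r)) = 1"
  using sonine[OF assms] unfolding conv_commute[of m] by (simp add: conv_def mult.commute)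

lemma K_op_const: "0 \<le> x \<Longrightarrow> K_op m k (\<lambda>_. c) x = c"
  using kernel_integral_const[of x] by (auto simp: K_op_def)

lemma K_op_bound_const:
  assumes g: "continuous_on {0..T} g" and "0 \<le> x" "x \<le> T" "\<And>r. 0 \<le> r \<Longrightarrow> r \<le> x \<Longrightarrow> \<bar>g r\<bar> \<le> e"
  shows "\<bar>K_op m k g x\<bar> \<le> e"
proof (cases "x = 0")
  case True
  then show ?thesis using assms by (simp add: K_op_def)
next
  case False
  have "\<bar>kernel_integral m k g x\<bar> \<le> (LINT r:{0<..<x}|lborel. e * (m r * k (x - r)))"
  proof (rule kernel_integral_bound[OF m k g \<open>x \<le> T\<close>])
    show "set_integrable lborel {0<..<x} (\<lambda>r. e * (m r * k (x - r)))"
      using kernel_product_integrable[OF m k] by simp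
    show "m r * k (x - r) * \<bar>g r\<bar> \<le> e * (m r * k (x - r))" if "0 < r" "r < x" for r
      using mult_left_mono[OF assms(4)[of r], of "m r * k (x - r)"] that
        decreasing_kernelD(3)[OF k, of "x - r"] decreasing_kernelD(3)[OF m, of r]
      by (simp add: mult_ac)
  qed
  then show ?thesis using kernel_integral_const[of x] False assms by (simp add: K_op_eq)
qed

text \<open>At \<open>0\<close> the mass one of the kernel decides:
  \<open>\<K> g x - g 0 = \<K> (g - g 0) x\<close> is an average over \<open>(0,x)\<close> of values
  that are small there. This is what makes \<open>\<K> \<phi> 0 = \<phi> 0\<close> the right
  convention.\<close>

lemma K_op_continuous:
  assumes g: "continuous_on {0..T} g"
  shows "continuous_on {0..T} (K_op m k g)"
proof (rule continuous_on_Icc_from_Ioc[OF _ _ T])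
  show "continuous_on {0<..T} (K_op m k g)"
    using continuous_on_kernel_integral[OF m k g]
    by (rule continuous_on_cong[THEN iffD1, rotated -1]) (auto simp: K_op_eq)
  show "(K_op m k g \<longlongrightarrow> K_op m k g 0) (at_right 0)"
  proof (rule tendstoI)
    fix e :: real assume e: "0 < e"
    have "(g \<longlongrightarrow> g 0) (at_right 0)"
      using g T by (auto simp: continuous_on_def at_within_Icc_at_right dest!: bspec[of _ _ 0])
    then have "eventually (\<lambda>x. dist (g x) (g 0) < e / 2) (at_right 0)"
      using e by (auto dest: tendstoD[of _ _ _ "e / 2"])
    then obtain d where d: "0 < d" "\<And>x. 0 < x \<Longrightarrow> x < d \<Longrightarrow> dist (g x) (g 0) < e / 2"
      by (auto simp: eventually_at_right_field)
    have *: "dist (K_op m k g x) (K_op m k g 0) < e" if x: "0 < x" "x < d" "x < T" for x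
    proof -
      have "\<bar>K_op m k (\<lambda>x. g x + (-1) * g 0) x\<bar> \<le> e / 2"
      proof (rule K_op_bound_const)
        show "\<bar>g r + - 1 * g 0\<bar> \<le> e / 2" if "0 \<le> r" "r \<le> x" for r
          using d(2)[of r] that x e by (cases "r = 0") (auto simp: dist_real_def)
      qed (use x g in \<open>auto intro!: continuous_intros\<close>)
      moreover have "K_op m k (\<lambda>x. g x + (-1) * g 0) x = K_op m k g x + (-1) * K_op m k (\<lambda>_. g 0) x"
        using x by (intro K_op_lin g) auto
      ultimately show ?thesis using x e by (simp add: K_op_const dist_real_def) (simp add: K_op_def)
    qed
    show "eventually (\<lambda>x. dist (K_op m k g x) (K_op m k g 0) < e) (at_right 0)"
      using eventually_at_right_real[OF T] eventually_at_right_real[OF d(1)]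
      by eventually_elim (use * in auto)
  qed
qed

lemma exp_continuous: "continuous_on {0..T} (\<lambda>s. exp (\<beta> * s :: real))"
  by (intro continuous_intros)

lemma kappa_nonneg: "0 \<le> \<kappa> \<beta> x"
  by (rule conv_k_nonneg) simp

lemma kappa_continuous: "continuous_on {0..T} (\<kappa> \<beta>)"
  by (rule conv_k_continuous[OF exp_continuous])

text \<open>As \<open>\<beta> \<ge> 0\<close>, the factor \<open>exp (\<beta> * r)\<close> is at
  most \<open>exp (\<beta> * x)\<close> on \<open>(0,x)\<close>, which reduces the claim to the case
  \<open>\<beta> = 0\<close>, the assumption on \<open>q\<close>.\<close>

lemma m_kappa_le:
  assumes "0 \<le> \<beta>" "x \<in> {0<..T}"
  shows "m x * \<kappa> \<beta> x \<le> q * exp (\<beta> * x)"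
proof -
  have "\<kappa> \<beta> x \<le> (LINT r:{0<..<x}|lborel. exp (\<beta> * x) * k (x - r))"
    unfolding conv_def
  proof (rule set_integral_mono)
    show "set_integrable lborel {0<..<x} (\<lambda>r. k (x - r) * exp (\<beta> * r))"
      using assms by (intro conv_k_integrable exp_continuous) auto
    show "set_integrable lborel {0<..<x} (\<lambda>r. exp (\<beta> * x) * k (x - r))"
      using k_reflect_integrable by simp
    show "k (x - r) * exp (\<beta> * r) \<le> exp (\<beta> * x) * k (x - r)" if "r \<in> {0<..<x}" for r
      using that assms decreasing_kernelD(3)[OF k, of "x - r"]
      by (auto simp: mult.commute[of "k _"] intro!: mult_right_mono mult_left_mono)
  qed
  then have "\<kappa> \<beta> x \<le> exp (\<beta> * x) * conv k (\<lambda>_. 1) x" by (simp add: conv_def)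
  then have "m x * \<kappa> \<beta> x \<le> exp (\<beta> * x) * (m x * conv k (\<lambda>_. 1) x)"
    using mult_left_mono[of "\<kappa> \<beta> x" "exp (\<beta> * x) * conv k (\<lambda>_. 1) x" "m x"]
      decreasing_kernelD(3)[OF m, of x] assms
    by (simp add: mult.left_commute)
  also have "\<dots> \<le> exp (\<beta> * x) * q" using q[OF assms(2)] by simp
  finally show ?thesis by (simp add: mult.commute)
qed

text \<open>The bound \<open>m \<kappa> \<le> q\<close> makes \<open>\<K>\<close> a strict contraction in the weight \<open>\<kappa>\<close>, although it
  fixes the constants.\<close>

lemma dominated_K:
  assumes \<beta>: "0 \<le> \<beta>"
  shows "dominated_operator T (K_op m k) (\<kappa> \<beta>) q"
proof
  show "\<bar>K_op m k \<phi> x\<bar> \<le> q * N * \<kappa> \<beta> x"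
    if \<phi>: "continuous_on {0..T} \<phi>" and N: "\<And>x. x \<in> {0..T} \<Longrightarrow> \<bar>\<phi> x\<bar> \<le> N * \<kappa> \<beta> x" "0 \<le> N"
      and x: "x \<in> {0..T}" for \<phi> N x
  proof (cases "x = 0")
    case True
    \<comment> \<open>The weight vanishes at \<open>0\<close>, so the hypothesis forces
      \<open>\<phi> 0 = 0\<close>; this is how the nonzero constants are excluded.\<close>
    then show ?thesis using N(1)[of 0] T by (simp add: K_op_def)
  next
    case False
    have "\<bar>kernel_integral m k \<phi> x\<bar> \<le> (LINT r:{0<..<x}|lborel. q * N * (k (x - r) * exp (\<beta> * r)))"
    proof (rule kernel_integral_bound[OF m k \<phi>])
      show "set_integrable lborel {0<..<x} (\<lambda>r. q * N * (k (x - r) * exp (\<beta> * r)))"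
        using conv_k_integrable[OF exp_continuous, of x] x by simp
      show "m r * k (x - r) * \<bar>\<phi> r\<bar> \<le> q * N * (k (x - r) * exp (\<beta> * r))" if r: "0 < r" "r < x" for r
      proof -
        have nn: "0 \<le> m r" "0 \<le> k (x - r)"
          using r decreasing_kernelD(3)[OF m] decreasing_kernelD(3)[OF k] by auto
        have "m r * k (x - r) * \<bar>\<phi> r\<bar> \<le> m r * k (x - r) * (N * \<kappa> \<beta> r)"
          using nn r x by (intro mult_left_mono N) auto
        also have "\<dots> = N * k (x - r) * (m r * \<kappa> \<beta> r)" by simp
        also have "\<dots> \<le> N * k (x - r) * (q * exp (\<beta> * r))"
          using nn r x N(2) by (intro mult_left_mono m_kappa_le \<beta>) auto
        finally show ?thesis by (simp add: mult_ac)
      qed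
    qed (use x in simp)
    then show ?thesis using False by (simp add: K_op_eq conv_def)
  qed
  show "K_op m k (\<lambda>x. \<phi> x + c * \<psi> x) x = K_op m k \<phi> x + c * K_op m k \<psi> x"
    if "continuous_on {0..T} \<phi>" "continuous_on {0..T} \<psi>" "x \<in> {0..T}" for \<phi> \<psi> c x
    using that by (intro K_op_lin) auto
qed (auto intro!: K_op_continuous kappa_continuous kappa_nonneg q_nonneg q_less)

text \<open>Otherwise \<open>k\<close> would vanish almost everywhere on \<open>(0,x)\<close> and
  \<open>m * k\<close> would be \<open>0\<close> instead of \<open>1\<close>. Positivity allows
  division by \<open>\<kappa>\<close> away from \<open>0\<close>.\<close>

lemma kappa_pos:
  assumes x: "0 < x"
  shows "0 < conv k (\<lambda>_. 1) x"
proof (rule ccontr)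
  assume "\<not> 0 < conv k (\<lambda>_. 1) x"
  then have "conv k (\<lambda>_. 1) x = 0" using conv_k_nonneg[of x "\<lambda>_. 1"] by auto
  then have "(\<integral>s. indicator {0<..<x} s * k s \<partial>lborel) = 0"
    by (simp add: conv_one_right set_lebesgue_integral_def)
  moreover have "integrable lborel (\<lambda>s. indicator {0<..<x} s * k s)"
    using decreasing_kernelD(5)[OF k, of x] by (simp add: set_integrable_def)
  moreover have "0 \<le> indicator {0<..<x} s * k s" for s
    using decreasing_kernelD(3)[OF k] by (auto simp: indicator_def)
  ultimately have z: "AE s in lborel. indicator {0<..<x} s * k s = 0"
    by (subst integral_nonneg_eq_0_iff_AE[symmetric]) auto
  have "conv m k x = (\<integral>s. 0 \<partial>(lborel :: real measure))"
    unfolding conv_def set_lebesgue_integral_def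
  proof (rule integral_cong_AE)
    note [measurable] = decreasing_kernelD(1)[OF m] decreasing_kernelD(1)[OF k]
    show "(\<lambda>s. indicator {0<..<x} s *\<^sub>R (m (x - s) * k s)) \<in> borel_measurable lborel" by measurable
    show "AE s in lborel. indicator {0<..<x} s *\<^sub>R (m (x - s) * k s) = 0"
      using z by eventually_elim auto
  qed simp
  then show False using sonine[OF x] by simp
qed

text \<open>Near \<open>0\<close> a fixed point \<open>d\<close> with \<open>d(0) = 0\<close> is small, and away from \<open>0\<close> it is controlled by the
  weight \<open>\<kappa>\<close>, which \<open>\<K>\<close> contracts.\<close>

lemma K_fixed_point_zero:
  assumes d: "continuous_on {0..T} d" "d 0 = 0" and fixpt: "\<And>x. x \<in> {0..T} \<Longrightarrow> d x = K_op m k d x"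
    and x: "x \<in> {0..T}"
  shows "d x = 0"
proof -
  interpret K: dominated_operator T "K_op m k" "\<kappa> 0" q by (rule dominated_K) simp
  have "\<bar>d x\<bar> \<le> e" if e: "0 < e" for e
  proof -
    have "(d \<longlongrightarrow> d 0) (at_right 0)"
      using d(1) T by (auto simp: continuous_on_def at_within_Icc_at_right dest!: bspec[of _ _ 0])
    then have "eventually (\<lambda>x. dist (d x) (d 0) < e) (at_right 0)"
      using e by (rule tendstoD)
    then obtain \<delta> where \<delta>: "0 < \<delta>" "\<And>x. 0 < x \<Longrightarrow> x < \<delta> \<Longrightarrow> \<bar>d x\<bar> < e"
      by (auto simp: eventually_at_right_field dist_real_def d)
    have pos: "0 < \<kappa> 0 x" if "0 < x" for x using kappa_pos[OF that] by simp
    have "continuous_on {\<delta>..T} (\<lambda>x. d x / \<kappa> 0 x)"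
    proof (intro continuous_on_divide ballI)
      show "continuous_on {\<delta>..T} d" "continuous_on {\<delta>..T} (\<kappa> 0)"
        using \<delta>(1)
        by (intro continuous_on_subset[OF d(1)] continuous_on_subset[OF kappa_continuous]; simp)+
      show "\<kappa> 0 x \<noteq> 0" if "x \<in> {\<delta>..T}" for x
        using pos[of x] that \<delta>(1) by simp
    qed
    \<comment> \<open>\<open>C\<close> depends on \<open>\<delta>\<close> and hence on
      \<open>e\<close>. This is harmless, as \<open>n\<close> tends to infinity while
      \<open>e\<close> stays fixed.\<close>
    then obtain C where C: "0 \<le> C" "\<And>x. x \<in> {\<delta>..T} \<Longrightarrow> \<bar>d x / \<kappa> 0 x\<bar> \<le> C"
      using continuous_on_Icc_bound by blast
    have "\<bar>d x\<bar> \<le> e + C * q ^ n * \<kappa> 0 x" if "x \<in> {0..T}" for n x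
      using that
    proof (induction n arbitrary: x)
      case 0
      show ?case
      proof (cases "x < \<delta>")
        case True
        then have "\<bar>d x\<bar> \<le> e" using \<delta>(2)[of x] 0 d(2) e by (cases "x = 0") auto
        moreover have "0 \<le> C * \<kappa> 0 x" using C(1) kappa_nonneg by (rule mult_nonneg_nonneg)
        ultimately show ?thesis by simp
      next
        case False
        then have "\<bar>d x\<bar> / \<kappa> 0 x \<le> C" using C(2)[of x] 0 pos[of x] \<delta>(1) by (simp add: abs_divide)
        then show ?thesis using e pos[of x] False \<delta>(1) by (simp add: pos_divide_le_eq)
      qed
    next
      case (Suc n)
      \<comment> \<open>Truncation at height \<open>e\<close> separates the two parts of the bound:
        \<open>\<K>\<close> keeps \<open>c\<close> within \<open>[-e,e]\<close>, since it averages,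
        and multiplies the bound on the excess \<open>d - c\<close> by \<open>q\<close>.\<close>
      define c where "c x = max (-e) (min e (d x))" for x
      have c: "continuous_on {0..T} c" unfolding c_def by (intro continuous_intros d)
      have "\<bar>K_op m k c x\<bar> \<le> e"
        using Suc.prems e by (intro K_op_bound_const c) (auto simp: c_def)
      moreover have "\<bar>K_op m k (\<lambda>x. d x + (-1) * c x) x\<bar> \<le> q * (C * q ^ n) * \<kappa> 0 x"
      proof (rule K.dom[OF _ _ _ Suc.prems])
        show "continuous_on {0..T} (\<lambda>x. d x + (-1) * c x)" by (intro continuous_intros d c)
        show "\<bar>d y + (-1) * c y\<bar> \<le> C * q ^ n * \<kappa> 0 y" if "y \<in> {0..T}" for y
        proof -
          have "0 \<le> C * q ^ n * \<kappa> 0 y"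
            by (intro mult_nonneg_nonneg kappa_nonneg zero_le_power C(1) q_nonneg)
          then show ?thesis using Suc.IH[OF that] e unfolding c_def by linarith
        qed
        show "0 \<le> C * q ^ n" using C(1) q_nonneg by simp
      qed
      moreover have "K_op m k (\<lambda>x. d x + (-1) * c x) x = K_op m k d x + (-1) * K_op m k c x"
        using Suc.prems by (intro K_op_lin c d) auto
      ultimately have "\<bar>K_op m k d x\<bar> \<le> e + q * (C * q ^ n) * \<kappa> 0 x" by linarith
      then show ?case using fixpt[OF Suc.prems] by (simp add: mult_ac)
    qed
    then have "\<And>n. \<bar>d x\<bar> \<le> e + C * q ^ n * \<kappa> 0 x" using x by blast
    moreover have "(\<lambda>n. e + C * q ^ n * \<kappa> 0 x) \<longlonglongrightarrow> e + C * 0 * \<kappa> 0 x"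
      using q_nonneg q_less by (intro tendsto_intros LIMSEQ_power_zero) auto
    ultimately have "\<bar>d x\<bar> \<le> e + C * 0 * \<kappa> 0 x" by (intro LIMSEQ_le_const) auto
    then show ?thesis by simp
  qed
  then have "\<bar>d x\<bar> \<le> 0" using field_le_epsilon[of "\<bar>d x\<bar>" 0] by simp
  then show ?thesis by simp
qed

section \<open>The censored integral\<close>

lemma exp_dominates:
  assumes "0 \<le> \<beta>" "continuous_on {0..T} g"
  obtains N where "0 \<le> N" "\<And>x. x \<in> {0..T} \<Longrightarrow> \<bar>g x\<bar> \<le> N * exp (\<beta> * x)"
proof -
  obtain M where M: "0 \<le> M" "\<And>x. x \<in> {0..T} \<Longrightarrow> \<bar>g x\<bar> \<le> M"
    using continuous_on_Icc_bound[OF assms(2)] by blast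
  have "\<bar>g x\<bar> \<le> M * exp (\<beta> * x)" if "x \<in> {0..T}" for x
    using M(2)[OF that] mult_left_mono[of 1 "exp (\<beta> * x)" M] M(1) that assms(1) by auto
  then show thesis using that M(1) by blast
qed

context
  fixes g N \<beta>
  assumes g: "continuous_on {0..T} g" and gN: "\<And>x. x \<in> {0..T} \<Longrightarrow> \<bar>g x\<bar> \<le> N * exp (\<beta> * x)"
    and N: "0 \<le> N" and \<beta>: "0 \<le> \<beta>"
begin

lemma conv_k_le_kappa: "x \<in> {0..T} \<Longrightarrow> \<bar>conv k g x\<bar> \<le> N * \<kappa> \<beta> x"
  using gN by (intro conv_k_bound[OF g exp_continuous]) auto

text \<open>\<open>I_Ce\<close> itself does not involve \<open>\<beta>\<close>. The choice
  \<open>\<beta> = 0\<close> yields its qualitative properties; a large \<open>\<beta>\<close>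
  serves to make the bound in the third claim small against
  \<open>exp (\<beta> * x)\<close>.\<close>

lemma neumann_K:
  shows "continuous_on {0..T} (I_Ce m k g)"
    and "x \<in> {0..T} \<Longrightarrow> I_Ce m k g x = conv k g x + K_op m k (I_Ce m k g) x"
    and "x \<in> {0..T} \<Longrightarrow> \<bar>I_Ce m k g x\<bar> \<le> N / (1 - q) * \<kappa> \<beta> x"
proof -
  interpret K: dominated_operator T "K_op m k" "\<kappa> \<beta>" q by (rule dominated_K[OF \<beta>])
  note h = conv_k_continuous[OF g]
  have I: "I_Ce m k g = (\<lambda>x. \<Sum>j. (K_op m k ^^ j) (conv k g) x)"
    by (simp add: I_Ce_def I_R_eq fun_eq_iff)
  show "continuous_on {0..T} (I_Ce m k g)"
    unfolding I by (rule K.neumann_continuous[OF h conv_k_le_kappa N])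
  show "I_Ce m k g x = conv k g x + K_op m k (I_Ce m k g) x" if "x \<in> {0..T}"
    unfolding I by (rule K.neumann_equation[OF h conv_k_le_kappa N that])
  show "\<bar>I_Ce m k g x\<bar> \<le> N / (1 - q) * \<kappa> \<beta> x" if "x \<in> {0..T}"
    unfolding I by (rule K.neumann_bound[OF h conv_k_le_kappa N that])
qed

end

lemma I_Ce_continuous:
  assumes g: "continuous_on {0..T} g"
  shows "continuous_on {0..T} (I_Ce m k g)"
proof -
  obtain N where N: "0 \<le> N" "\<And>x. x \<in> {0..T} \<Longrightarrow> \<bar>g x\<bar> \<le> N * exp (0 * x)"
    using exp_dominates[OF order_refl g] by blast
  show ?thesis by (rule neumann_K(1)[OF g N(2,1) order_refl])
qed

lemma I_Ce_equation:
  assumes g: "continuous_on {0..T} g" and x: "x \<in> {0..T}"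
  shows "I_Ce m k g x = conv k g x + K_op m k (I_Ce m k g) x"
proof -
  obtain N where N: "0 \<le> N" "\<And>x. x \<in> {0..T} \<Longrightarrow> \<bar>g x\<bar> \<le> N * exp (0 * x)"
    using exp_dominates[OF order_refl g] by blast
  show ?thesis by (rule neumann_K(2)[OF g N(2,1) order_refl x])
qed

lemma I_Ce_0:
  assumes g: "continuous_on {0..T} g"
  shows "I_Ce m k g 0 = 0"
proof -
  obtain N where N: "0 \<le> N" "\<And>x. x \<in> {0..T} \<Longrightarrow> \<bar>g x\<bar> \<le> N * exp (0 * x)"
    using exp_dominates[OF order_refl g] by blast
  show ?thesis using neumann_K(3)[OF g N(2,1) order_refl, of 0] T by simp
qed

text \<open>The difference to \<open>I_Ce m k g\<close> is a fixed point of \<open>\<K>\<close> that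
  vanishes at \<open>0\<close>. Since \<open>w\<close> need not be dominated by
  \<open>\<kappa>\<close>, this rests on \<open>K_fixed_point_zero\<close>. It replaces
  manipulations of the series below, beginning with linearity.\<close>

lemma I_Ce_unique:
  assumes g: "continuous_on {0..T} g" and w: "continuous_on {0..T} w" "w 0 = 0"
    and eq: "\<And>x. x \<in> {0..T} \<Longrightarrow> w x = conv k g x + K_op m k w x" and x: "x \<in> {0..T}"
  shows "w x = I_Ce m k g x"
proof -
  let ?d = "\<lambda>x. w x + (-1) * I_Ce m k g x"
  have "?d x = 0"
  proof (rule K_fixed_point_zero[OF _ _ _ x])
    show "continuous_on {0..T} ?d" by (intro continuous_intros w I_Ce_continuous g)
    show "?d 0 = 0" using w I_Ce_0[OF g] by simp
    show "?d y = K_op m k ?d y" if "y \<in> {0..T}" for y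
      using K_op_lin[OF w(1) I_Ce_continuous[OF g], of y "-1"] eq[OF that] I_Ce_equation[OF g that] that
      by simp
  qed
  then show ?thesis by simp
qed

lemma I_Ce_lin:
  assumes g: "continuous_on {0..T} g" and h: "continuous_on {0..T} h" and x: "x \<in> {0..T}"
  shows "I_Ce m k (\<lambda>x. g x + c * h x) x = I_Ce m k g x + c * I_Ce m k h x"
proof (rule I_Ce_unique[symmetric, OF _ _ _ _ x])
  show "I_Ce m k g y + c * I_Ce m k h y
      = conv k (\<lambda>x. g x + c * h x) y + K_op m k (\<lambda>x. I_Ce m k g x + c * I_Ce m k h x) y"
    if y: "y \<in> {0..T}" for y
    using K_op_lin[OF I_Ce_continuous[OF g] I_Ce_continuous[OF h], of y c] conv_k_lin[OF g h, of y c] y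
    by (simp add: I_Ce_equation[OF g y] I_Ce_equation[OF h y] algebra_simps)
qed (auto intro!: continuous_intros I_Ce_continuous g h simp: I_Ce_0 g h)

text \<open>\<open>\<kappa> \<beta> x\<close> is \<open>exp (\<beta> * x)\<close> times a truncated
  Laplace transform of \<open>k\<close> at \<open>\<beta>\<close>. A large \<open>\<beta>\<close>
  makes this factor as small as desired, which compensates any size of \<open>l\<close> without
  shortening the interval.\<close>

lemma dominated_I_Ce:
  obtains \<beta> where "0 \<le> \<beta>" "dominated_operator T (\<lambda>g y. l * I_Ce m k g y) (\<lambda>x. exp (\<beta> * x)) (1 / 2)"
proof -
  \<comment> \<open>Chosen so that the contraction factor \<open>\<bar>l\<bar> * e / (1 - q)\<close>
    is at most \<open>1 / 2\<close>; the summand \<open>1\<close> keeps the denominator positive for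
    \<open>l = 0\<close>.\<close>
  define e where "e = (1 - q) / (2 * (\<bar>l\<bar> + 1))"
  have e: "0 < e" "\<bar>l\<bar> * e / (1 - q) \<le> 1 / 2"
  proof -
    have "\<bar>l\<bar> * e / (1 - q) = \<bar>l\<bar> / (2 * (\<bar>l\<bar> + 1))" using q_less by (simp add: e_def)
    also have "\<dots> \<le> 1 / 2" by (simp add: divide_simps)
    finally show "\<bar>l\<bar> * e / (1 - q) \<le> 1 / 2" .
  qed (use q_less in \<open>auto simp: e_def\<close>)
  obtain \<beta> where \<beta>: "0 \<le> \<beta>" "\<And>x. 0 < x \<Longrightarrow> (LINT s:{0<..<x}|lborel. exp (- \<beta> * s) * k s) \<le> e"
    using laplace_k[OF e(1)] by blast
  have kappa_le: "\<kappa> \<beta> x \<le> e * exp (\<beta> * x)" if x: "x \<in> {0..T}" for x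
  proof (cases "x = 0")
    case False
    have "\<kappa> \<beta> x = (LINT s:{0<..<x}|lborel. exp (\<beta> * (x - s)) * k s)"
      unfolding conv_commute[of k] by (simp add: conv_def)
    also have "\<dots> = (LINT s:{0<..<x}|lborel. exp (\<beta> * x) * (exp (- \<beta> * s) * k s))"
      by (simp add: algebra_simps exp_diff exp_minus field_simps)
    also have "\<dots> = exp (\<beta> * x) * (LINT s:{0<..<x}|lborel. exp (- \<beta> * s) * k s)" by simp
    also have "\<dots> \<le> exp (\<beta> * x) * e" using \<beta>(2)[of x] x False by auto
    finally show ?thesis by (simp add: mult.commute)
  qed (use e in simp)
  show thesis
  proof (rule that[OF \<beta>(1)], unfold_locales)
    show "\<bar>l * I_Ce m k \<phi> x\<bar> \<le> 1 / 2 * N * exp (\<beta> * x)"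
      if \<phi>: "continuous_on {0..T} \<phi>" and N: "\<And>x. x \<in> {0..T} \<Longrightarrow> \<bar>\<phi> x\<bar> \<le> N * exp (\<beta> * x)" "0 \<le> N"
        and x: "x \<in> {0..T}" for \<phi> N x
    proof -
      have "\<bar>I_Ce m k \<phi> x\<bar> \<le> N / (1 - q) * (e * exp (\<beta> * x))"
        using neumann_K(3)[OF \<phi> N \<beta>(1) x] mult_left_mono[OF kappa_le[OF x], of "N / (1 - q)"] N(2) q_less
        by simp
      then have "\<bar>l * I_Ce m k \<phi> x\<bar> \<le> \<bar>l\<bar> * (N / (1 - q) * (e * exp (\<beta> * x)))"
        unfolding abs_mult by (rule mult_left_mono) simp
      also have "\<dots> = (\<bar>l\<bar> * e / (1 - q)) * (N * exp (\<beta> * x))" by simp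
      also have "\<dots> \<le> 1 / 2 * (N * exp (\<beta> * x))" using N(2) by (intro mult_right_mono e) auto
      finally show ?thesis by simp
    qed
  qed (auto intro!: continuous_intros I_Ce_continuous simp: I_Ce_lin algebra_simps)
qed

section \<open>The initial value problem as a fixed point equation\<close>

context
  fixes \<phi> :: "real \<Rightarrow> real" and l :: real
  assumes \<phi>: "continuous_on {0..T} \<phi>"
begin

text \<open>The equation \<open>D_Ce \<phi> = l * \<phi>\<close> reads
  \<open>D_R \<phi> = v\<close>: the censoring term is moved to the right-hand side. Through
  \<open>m\<close> the function may be singular at \<open>0\<close>, so it is only continuous on
  \<open>(0,T]\<close>.\<close>

abbreviation "v \<equiv> \<lambda>r. m r * \<phi> r + l * \<phi> r"

lemma v_continuous: "continuous_on {0<..T} v"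
  using decreasing_kernelD(2)[OF m] \<phi> by (auto intro!: continuous_intros intro: continuous_on_subset)

lemma phi_integrable: "x \<le> T \<Longrightarrow> set_integrable lborel {0<..<x} \<phi>"
  using set_integrable_mult_bounded[OF decreasing_kernelD(5)[OF decreasing_kernel_one] \<phi>] by simp

lemma v_integrable:
  assumes "x \<le> T"
  shows "set_integrable lborel {0<..<x} v"
  using set_integrable_mult_bounded[OF decreasing_kernelD(5)[OF m] \<phi> assms] phi_integrable[OF assms]
  by (intro set_integral_add) auto

text \<open>The origin of \<open>K_op\<close>: it is what convolution with \<open>k\<close>, the
  inverse of \<open>D_R\<close>, makes of the censoring term \<open>m r * \<phi> r\<close>.\<close>

lemma conv_k_v:
  assumes x: "x \<in> {0<..T}"
  shows "conv k v x = K_op m k \<phi> x + l * conv k \<phi> x"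
proof -
  have "conv k v x = (LINT r:{0<..<x}|lborel. m r * k (x - r) * \<phi> r + l * (k (x - r) * \<phi> r))"
    by (simp add: conv_def algebra_simps)
  also have "\<dots> = kernel_integral m k \<phi> x + l * conv k \<phi> x"
    using kernel_integral_integrable[OF m k \<phi>, of x] conv_k_integrable[OF \<phi>, of x] x
    by (simp add: conv_def kernel_integral_def)
  finally show ?thesis using x by (simp add: K_op_eq)
qed

text \<open>The function \<open>c\<close> is controlled on \<open>(0,T]\<close> only, so
  \<open>conv_assoc\<close> is applied to its extension by zero, which is Borel on the whole
  line.\<close>

lemma conv_assoc_Ioc:
  assumes a: "decreasing_kernel a" and b: "decreasing_kernel b" and c: "continuous_on {0<..T} c"
    and d: "\<And>y. 0 < y \<Longrightarrow> y < x \<Longrightarrow> conv a b y = d y"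
    and dc: "set_integrable lborel {0<..<x} (\<lambda>r. d (x - r) * c r)" and x: "x \<le> T"
  shows "conv a (conv b c) x = conv d c x"
proof -
  let ?c = "\<lambda>r. indicator {0<..T} r * c r"
  have "conv a (conv b ?c) x = conv d ?c x"
  proof (rule conv_assoc)
    show "set_integrable lborel {0<..<y} (\<lambda>s. a (y - s) * b s)" for y
      using kernel_product_integrable[OF b a, of y] by (simp add: mult.commute)
    show "set_integrable lborel {0<..<x} (\<lambda>r. d (x - r) * ?c r)"
      using dc unfolding set_integrable_def
      by (rule Bochner_Integration.integrable_cong[THEN iffD1, rotated -1]) (use x in \<open>auto simp: indicator_def\<close>)
  qed (use a b d continuous_imp_restr_measurable[OF c] in \<open>auto simp: decreasing_kernel_def\<close>)
  moreover have "conv a (conv b ?c) x = conv a (conv b c) x" "conv d ?c x = conv d c x"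
    using x by (auto intro!: conv_cong)
  ultimately show ?thesis by simp
qed

text \<open>\<open>m * \<phi> = m * (k * v) = 1 * v\<close>.\<close>

lemma fixed_point_imp_solution:
  assumes fixpt: "\<And>x. x \<in> {0<..T} \<Longrightarrow> \<phi> x = K_op m k \<phi> x + l * conv k \<phi> x"
  shows "\<phi> \<in> C_Icc m T" "\<And>x. x \<in> {0<..T} \<Longrightarrow> D_Ce m T \<phi> x = l * \<phi> x"
proof -
  have eq: "conv m \<phi> x = (LINT s:{0<..<x}|lborel. v s)" if x: "x \<in> {0<..T}" for x
  proof -
    have "conv m \<phi> x = conv m (conv k v) x"
      using fixpt x by (intro conv_cong_right) (auto simp: conv_k_v)
    also have "\<dots> = conv (\<lambda>_. 1) v x"
      using x sonine v_integrable[of x] by (intro conv_assoc_Ioc m k v_continuous) auto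
    finally show ?thesis by (simp add: conv_one_left)
  qed
  have der: "(conv m \<phi> has_real_derivative v x) (at x within {0<..T})" if x: "x \<in> {0<..T}" for x
    using primitive_has_derivative[OF v_continuous v_integrable[OF order_refl] x]
    by (rule has_field_derivative_transform_within[of _ _ _ _ 1]) (use eq x in auto)
  have "set_integrable lborel {0..T} \<phi>"
    using borel_integrable_atLeastAtMost'[OF \<phi>] .
  then have "set_integrable lborel {0<..T} \<phi>" by (rule set_integrable_subset) auto
  moreover have "C1_on T (conv m \<phi>)"
    unfolding C1_on_def using v_continuous der by blast
  ultimately show "\<phi> \<in> C_Icc m T"
    using \<phi> by (auto simp: C_Icc_def C_Ioc_def intro: continuous_on_subset)
  show "D_Ce m T \<phi> x = l * \<phi> x" if x: "x \<in> {0<..T}" for x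
    using vector_derivative_within[OF at_within_Ioc_neq_bot[OF x]
        der[OF x, unfolded has_real_derivative_iff_has_vector_derivative]]
    by (simp add: D_Ce_def D_R_def)
qed

text \<open>\<open>1 * \<phi> = k * m * \<phi> = k * 1 * v = 1 * (k * v)\<close>; then differentiate.\<close>

lemma solution_imp_fixed_point:
  assumes C: "\<phi> \<in> C_Icc m T" and D: "\<And>x. x \<in> {0<..T} \<Longrightarrow> D_Ce m T \<phi> x = l * \<phi> x"
    and x: "x \<in> {0<..T}"
  shows "\<phi> x = K_op m k \<phi> x + l * conv k \<phi> x"
proof -
  have der: "(conv m \<phi> has_real_derivative v y) (at y within {0<..T})" if y: "y \<in> {0<..T}" for y
  proof -
    obtain u' where u': "(conv m \<phi> has_real_derivative u' y) (at y within {0<..T})"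
      using C y unfolding C_Icc_def C_Ioc_def C1_on_def by blast
    then have "D_R m T \<phi> y = u' y"
      unfolding D_R_def has_real_derivative_iff_has_vector_derivative
      by (rule vector_derivative_within[OF at_within_Ioc_neq_bot[OF y]])
    then have "u' y = v y" using D[OF y] by (simp add: D_Ce_def algebra_simps)
    then show ?thesis using u' by simp
  qed
  have eq: "conv m \<phi> y = conv (\<lambda>_. 1) v y" if y: "y \<in> {0<..T}" for y
    unfolding conv_one_left
    by (rule derivative_eq_primitive[OF T v_continuous v_integrable[OF order_refl] der
        kernel_conv_tendsto_0[OF m \<phi>] y])
  \<comment> \<open>The interchange of \<open>k\<close> and \<open>1\<close> passes through
    \<open>?\<kappa> * v\<close>, to which both triple convolutions are equal. As
    \<open>?\<kappa>\<close> is continuous on \<open>[0,T]\<close> and \<open>v\<close> integrable,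
    the integrability demanded by associativity holds.\<close>
  let ?\<kappa> = "conv k (\<lambda>_. 1)"
  have "(LINT s:{0<..<y}|lborel. \<phi> s) = (LINT s:{0<..<y}|lborel. K_op m k \<phi> s + l * conv k \<phi> s)"
    if y: "y \<in> {0<..T}" for y
  proof -
    have \<kappa>v: "set_integrable lborel {0<..<y} (\<lambda>r. ?\<kappa> (y - r) * v r)"
    proof -
      have "continuous_on {0..y} (\<lambda>r. ?\<kappa> (y - r))"
        using y by (intro continuous_on_compose2[OF conv_k_continuous[of "\<lambda>_. 1"]] continuous_intros) auto
      from set_integrable_mult_bounded[OF v_integrable this order_refl] y
      show ?thesis by (simp add: mult.commute)
    qed
    have "conv (\<lambda>_. 1) \<phi> y = conv k (conv m \<phi>) y"
      using \<phi> y sonine phi_integrable[of y]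
      by (intro conv_assoc_Ioc[symmetric] k m) (auto intro: continuous_on_subset simp: conv_commute[of k])
    also have "\<dots> = conv k (conv (\<lambda>_. 1) v) y" using eq y by (intro conv_cong_right) auto
    also have "\<dots> = conv ?\<kappa> v y"
      using \<kappa>v y by (intro conv_assoc_Ioc k decreasing_kernel_one v_continuous) auto
    also have "\<dots> = conv (\<lambda>_. 1) (conv k v) y"
      using \<kappa>v y
      by (intro conv_assoc_Ioc[symmetric] k decreasing_kernel_one v_continuous) (auto simp: conv_commute[of _ k])
    also have "\<dots> = conv (\<lambda>_. 1) (\<lambda>s. K_op m k \<phi> s + l * conv k \<phi> s) y"
      using y by (intro conv_cong_right) (auto simp: conv_k_v)
    finally show ?thesis by (simp add: conv_one_left)
  qed
  note eq2 = this
  have c: "continuous_on {0..T} (\<lambda>s. K_op m k \<phi> s + l * conv k \<phi> s)"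
    by (intro continuous_intros K_op_continuous conv_k_continuous \<phi>)
  have Ioc: "continuous_on {0<..T} f \<and> set_integrable lborel {0<..<T} f"
    if f: "continuous_on {0..T} f" for f :: "real \<Rightarrow> real"
    using f set_integrable_mult_bounded[OF decreasing_kernelD(5)[OF decreasing_kernel_one] f order_refl]
    by (auto intro: continuous_on_subset)
  have "((\<lambda>y. LINT s:{0<..<y}|lborel. \<phi> s) has_real_derivative \<phi> x) (at x within {0<..T})"
    using Ioc[OF \<phi>] by (intro primitive_has_derivative x) auto
  moreover have "((\<lambda>y. LINT s:{0<..<y}|lborel. K_op m k \<phi> s + l * conv k \<phi> s)
      has_real_derivative K_op m k \<phi> x + l * conv k \<phi> x) (at x within {0<..T})"
    using Ioc[OF c] by (intro primitive_has_derivative x) auto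
  then have "((\<lambda>y. LINT s:{0<..<y}|lborel. \<phi> s) has_real_derivative K_op m k \<phi> x + l * conv k \<phi> x)
      (at x within {0<..T})"
    by (rule has_field_derivative_transform_within[of _ _ _ _ 1]) (use eq2 x in auto)
  ultimately show ?thesis
    unfolding has_real_derivative_iff_has_vector_derivative
    using vector_derivative_within[OF at_within_Ioc_neq_bot[OF x]] by metis
qed

end

text \<open>The constant \<open>\<phi>0\<close> is reproduced by \<open>\<K>\<close> and may be
  subtracted from both sides of the fixed point equation. The rest vanishes at \<open>0\<close>, so
  \<open>I_Ce_unique\<close> identifies it as the censored integral of \<open>l * \<phi>\<close>.
  Conversely, \<open>\<K>\<close> applied to \<open>\<phi>0 + l * I_Ce \<phi>\<close> is evaluated
  by \<open>I_Ce_equation\<close>.\<close>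

lemma solves_ivp_iff:
  "solves_ivp m T l \<phi>0 \<phi> \<longleftrightarrow> continuous_on {0..T} \<phi> \<and>
     (\<forall>x\<in>{0..T}. \<phi> x = \<phi>0 + l * I_Ce m k \<phi> x)"
proof (intro iffI conjI ballI; (elim conjE)?)
  fix x
  assume S: "solves_ivp m T l \<phi>0 \<phi>" and x: "x \<in> {0..T}"
  have \<phi>: "continuous_on {0..T} \<phi>" using S by (simp add: solves_ivp_def C_Icc_def)
  have l\<phi>: "continuous_on {0..T} (\<lambda>x. l * \<phi> x)" by (intro continuous_intros \<phi>)
  have fp: "\<phi> x = K_op m k \<phi> x + l * conv k \<phi> x" if "x \<in> {0<..T}" for x
    using S that by (intro solution_imp_fixed_point[OF \<phi>]) (auto simp: solves_ivp_def)
  have "\<phi> x + (-1) * \<phi>0 = I_Ce m k (\<lambda>x. l * \<phi> x) x"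
  proof (rule I_Ce_unique[OF l\<phi> _ _ _ x])
    show "continuous_on {0..T} (\<lambda>x. \<phi> x + (-1) * \<phi>0)" by (intro continuous_intros \<phi>)
    show "\<phi> 0 + (-1) * \<phi>0 = 0" using S by (simp add: solves_ivp_def)
    show "\<phi> y + (-1) * \<phi>0 = conv k (\<lambda>x. l * \<phi> x) y + K_op m k (\<lambda>x. \<phi> x + (-1) * \<phi>0) y"
      if y: "y \<in> {0..T}" for y
    proof (cases "y = 0")
      case True
      then show ?thesis by (simp add: K_op_def)
    next
      case False
      have "conv k (\<lambda>x. 0 + l * \<phi> x) y = conv k (\<lambda>_. 0) y + l * conv k \<phi> y"
        using y by (intro conv_k_lin \<phi>) auto
      moreover have "conv k (\<lambda>_. 0) y = 0" by (simp add: conv_def)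
      moreover have "K_op m k (\<lambda>x. \<phi> x + (-1) * \<phi>0) y = K_op m k \<phi> y + (-1) * K_op m k (\<lambda>_. \<phi>0) y"
        using y by (intro K_op_lin \<phi>) auto
      ultimately show ?thesis using fp[of y] y False by (simp add: K_op_const)
    qed
  qed
  \<comment> \<open>Homogeneity in the shape required by \<open>I_Ce_lin\<close>:
    \<open>l * \<phi>\<close> is written as \<open>\<phi> + (l - 1) * \<phi>\<close>.\<close>
  moreover have "I_Ce m k (\<lambda>x. \<phi> x + (l - 1) * \<phi> x) x = I_Ce m k \<phi> x + (l - 1) * I_Ce m k \<phi> x"
    by (rule I_Ce_lin[OF \<phi> \<phi> x])
  then have "I_Ce m k (\<lambda>x. l * \<phi> x) x = l * I_Ce m k \<phi> x" by (simp add: algebra_simps)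
  ultimately show "\<phi> x = \<phi>0 + l * I_Ce m k \<phi> x" by simp
next
  assume \<phi>: "continuous_on {0..T} \<phi>" and eq: "\<forall>x\<in>{0..T}. \<phi> x = \<phi>0 + l * I_Ce m k \<phi> x"
  \<comment> \<open>Supplies \<open>K.cong\<close>: the equation for \<open>\<phi>\<close> is known
    on \<open>[0,T]\<close> only, while \<open>K_op\<close> takes a total function.\<close>
  interpret K: dominated_operator T "K_op m k" "\<kappa> 0" q by (rule dominated_K) simp
  have "\<phi> x = K_op m k \<phi> x + l * conv k \<phi> x" if x: "x \<in> {0<..T}" for x
  proof -
    have "K_op m k \<phi> x = K_op m k (\<lambda>x. \<phi>0 + l * I_Ce m k \<phi> x) x"
      using eq x by (intro K.cong \<phi> continuous_intros I_Ce_continuous) auto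
    also have "\<dots> = K_op m k (\<lambda>_. \<phi>0) x + l * K_op m k (I_Ce m k \<phi>) x"
      using x by (intro K_op_lin continuous_intros I_Ce_continuous \<phi>) auto
    also have "\<dots> = \<phi>0 + l * (I_Ce m k \<phi> x - conv k \<phi> x)"
      using x I_Ce_equation[OF \<phi>, of x] by (simp add: K_op_const)
    finally show ?thesis using eq x by (simp add: algebra_simps)
  qed
  note fixed_point_imp_solution[OF \<phi> this]
  moreover have "\<phi> 0 = \<phi>0" using eq T I_Ce_0[OF \<phi>] by simp
  ultimately show "solves_ivp m T l \<phi>0 \<phi>" by (simp add: solves_ivp_def)
qed (simp add: solves_ivp_def C_Icc_def)

theorem ivp_well_posed:
  "\<exists>\<phi>. solves_ivp m T l \<phi>0 \<phi> \<and>
     (\<forall>\<psi>. solves_ivp m T l \<phi>0 \<psi> \<longrightarrow> (\<forall>x\<in>{0..T}. \<psi> x = \<phi> x)) \<and>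
     (\<forall>x\<in>{0..T}. summable (\<lambda>j. ((\<lambda>g y. l * I_Ce m k g y) ^^ j) (\<lambda>_. 1) x) \<and>
        \<phi> x = \<phi>0 * (\<Sum>j. ((\<lambda>g y. l * I_Ce m k g y) ^^ j) (\<lambda>_. 1) x))"
proof -
  let ?L = "\<lambda>g y. l * I_Ce m k g y"
  obtain \<beta> where \<beta>: "0 \<le> \<beta>" and dom: "dominated_operator T ?L (\<lambda>x. exp (\<beta> * x)) (1 / 2)"
    by (rule dominated_I_Ce)
  interpret L: dominated_operator T ?L "\<lambda>x. exp (\<beta> * x)" "1 / 2" by (rule dom)
  have one: "continuous_on {0..T} (\<lambda>_. 1 :: real)" "\<And>x. x \<in> {0..T} \<Longrightarrow> \<bar>1 :: real\<bar> \<le> 1 * exp (\<beta> * x)"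
      "0 \<le> (1 :: real)"
    using \<beta> by auto
  define w where "w x = (\<Sum>j. (?L ^^ j) (\<lambda>_. 1) x)" for x
  have w: "continuous_on {0..T} w"
    using L.neumann_continuous[OF one] by (simp add: w_def[abs_def])
  have w_eq: "w x = 1 + l * I_Ce m k w x" if "x \<in> {0..T}" for x
    using L.neumann_equation[OF one that] by (simp add: w_def[abs_def])
  \<comment> \<open>The summand \<open>0\<close> matches the form of \<open>L.lin\<close>, which
    together with \<open>L.zero\<close> gives homogeneity.\<close>
  define \<phi> where "\<phi> x = 0 + \<phi>0 * w x" for x
  have \<phi>c: "continuous_on {0..T} \<phi>" unfolding \<phi>_def by (intro continuous_intros w)
  have "\<phi> x = \<phi>0 + l * I_Ce m k \<phi> x" if x: "x \<in> {0..T}" for x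
  proof -
    have "?L \<phi> x = ?L (\<lambda>_. 0) x + \<phi>0 * ?L w x"
      unfolding \<phi>_def using x by (intro L.lin w) auto
    then have "l * I_Ce m k \<phi> x = \<phi>0 * (l * I_Ce m k w x)" using L.zero[OF x] by simp
    moreover have "\<phi> x = \<phi>0 * w x" by (simp add: \<phi>_def)
    ultimately show ?thesis using arg_cong[OF w_eq[OF x], of "(*) \<phi>0"] by (simp only: distrib_left mult_1_right)
  qed
  then have sol: "solves_ivp m T l \<phi>0 \<phi>" using \<phi>c by (simp add: solves_ivp_iff)
  have unique: "\<psi> x = \<phi> x" if \<psi>: "solves_ivp m T l \<phi>0 \<psi>" and x: "x \<in> {0..T}" for \<psi> x
  proof -
    have \<psi>c: "continuous_on {0..T} \<psi>" using \<psi> by (simp add: solves_ivp_iff)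
    let ?d = "\<lambda>x. \<psi> x + (-1) * \<phi> x"
    have d: "continuous_on {0..T} ?d" by (intro continuous_intros \<psi>c \<phi>c)
    \<comment> \<open>An exponential weight dominates every continuous function on
      \<open>[0,T]\<close>, so here the contraction gives uniqueness in the full class.\<close>
    obtain N where N: "0 \<le> N" "\<And>x. x \<in> {0..T} \<Longrightarrow> \<bar>?d x\<bar> \<le> N * exp (\<beta> * x)"
      using exp_dominates[OF \<beta> d] by blast
    have "?d x = 0"
    proof (rule L.fixed_point_zero[OF d N(2,1) _ x])
      fix y assume y: "y \<in> {0..T}"
      have "\<psi> y = \<phi>0 + l * I_Ce m k \<psi> y" "\<phi> y = \<phi>0 + l * I_Ce m k \<phi> y"
        using \<psi> sol y by (simp_all add: solves_ivp_iff)
      then show "?d y = l * I_Ce m k ?d y"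
        using L.lin[OF \<psi>c \<phi>c y, of "-1"] by simp
    qed
    then show ?thesis by simp
  qed
  show ?thesis
  proof (intro exI[of _ \<phi>] conjI allI impI ballI)
    show "\<phi> x = \<phi>0 * (\<Sum>j. (?L ^^ j) (\<lambda>_. 1) x)" for x
      unfolding \<phi>_def w_def by (rule add_0)
    show "summable (\<lambda>j. (?L ^^ j) (\<lambda>_. 1) x)" if "x \<in> {0..T}" for x
      by (rule L.neumann_summable[OF one that])
  qed (fact sol unique)+
qed

end

section \<open>Laplace transforms\<close>

text \<open>Existence and value in one predicate, since the integral of a non-integrable function
  would be \<open>0\<close> by default. The values of \<open>a\<close> on \<open>{..0}\<close> do
  not enter.\<close>

definition has_laplace :: "(real \<Rightarrow> real) \<Rightarrow> real \<Rightarrow> real \<Rightarrow> bool" where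
  "has_laplace a l v \<longleftrightarrow>
     has_bochner_integral lborel (\<lambda>x. indicator {0<..} x * (exp (- l * x) * a x)) v"

text \<open>\<open>exp (- n * x)\<close> is the \<open>n\<close>-th power of
  \<open>t = exp (- x)\<close>, so the hypothesis annihilates all polynomials in \<open>t\<close>.
  Weierstrass approximation on \<open>[0,1]\<close> passes to continuous \<open>\<phi>\<close>, the
  error being controlled by the integral \<open>M\<close> of \<open>\<bar>G\<bar>\<close>; it is
  divided by \<open>M + 1\<close> because \<open>M\<close> may be \<open>0\<close>.\<close>

lemma weighted_moments_zero:
  fixes G \<phi> :: "real \<Rightarrow> real"
  assumes G: "set_integrable lborel {0<..} G"
    and moments: "\<And>n::nat. (LINT x:{0<..}|lborel. exp (- real n * x) * G x) = 0"
    and \<phi>: "continuous_on {0..1} \<phi>"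
  shows "set_integrable lborel {0<..} (\<lambda>x. \<phi> (exp (- x)) * G x)"
    and "(LINT x:{0<..}|lborel. \<phi> (exp (- x)) * G x) = 0"
proof -
  let ?G = "\<lambda>x. indicator {0<..} x * G x"
  have Gi: "integrable lborel ?G" using G by (simp add: set_integrable_def)
  note [measurable] = borel_measurable_integrable[OF Gi]
  have int: "set_integrable lborel {0<..} (\<lambda>x. \<psi> (exp (- x)) * G x) \<and>
      \<bar>LINT x:{0<..}|lborel. \<psi> (exp (- x)) * G x\<bar> \<le> e * (\<integral>x. \<bar>?G x\<bar> \<partial>lborel)"
    if \<psi>: "continuous_on {0..1} \<psi>" and e: "\<And>t. t \<in> {0..1} \<Longrightarrow> \<bar>\<psi> t\<bar> \<le> e" for \<psi> e
  proof -
    have c: "continuous_on {0<..} (\<lambda>x::real. \<psi> (exp (- x)))"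
      by (rule continuous_on_compose2[OF \<psi>]) (auto intro!: continuous_intros)
    note [measurable] = continuous_imp_restr_measurable[OF c]
    have eq: "indicator {0<..} x *\<^sub>R (\<psi> (exp (- x)) * G x) = indicator {0<..} x * \<psi> (exp (- x)) * ?G x" for x
      by (simp add: indicator_def)
    have bound: "\<bar>indicator {0<..} x * \<psi> (exp (- x)) * ?G x\<bar> \<le> e * \<bar>?G x\<bar>" for x
      using e[of "exp (- x)"] by (auto simp: indicator_def abs_mult intro!: mult_right_mono)
    have i: "integrable lborel (\<lambda>x. e * \<bar>?G x\<bar>)" using Gi by simp
    have i2: "integrable lborel (\<lambda>x. indicator {0<..} x * \<psi> (exp (- x)) * ?G x)"
    proof (rule Bochner_Integration.integrable_bound[OF i])
      show "(\<lambda>x. indicator {0<..} x * \<psi> (exp (- x)) * ?G x) \<in> borel_measurable lborel" by measurable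
      show "AE x in lborel. norm (indicator {0<..} x * \<psi> (exp (- x)) * ?G x) \<le> norm (e * \<bar>?G x\<bar>)"
        using bound by (intro AE_I2) (metis abs_ge_self order_trans real_norm_def)
    qed
    have "\<bar>\<integral>x. indicator {0<..} x * \<psi> (exp (- x)) * ?G x \<partial>lborel\<bar>
        \<le> (\<integral>x. \<bar>indicator {0<..} x * \<psi> (exp (- x)) * ?G x\<bar> \<partial>lborel)"
      by (rule integral_abs_bound)
    also have "\<dots> \<le> (\<integral>x. e * \<bar>?G x\<bar> \<partial>lborel)"
      by (rule integral_mono[OF integrable_abs[OF i2] i bound])
    finally have "\<bar>\<integral>x. indicator {0<..} x * \<psi> (exp (- x)) * ?G x \<partial>lborel\<bar> \<le> e * (\<integral>x. \<bar>?G x\<bar> \<partial>lborel)"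
      by simp
    then show ?thesis
      unfolding set_integrable_def set_lebesgue_integral_def eq using i2 by blast
  qed
  have int': "set_integrable lborel {0<..} (\<lambda>x. \<psi> (exp (- x)) * G x)"
    if \<psi>: "continuous_on {0..1} \<psi>" for \<psi>
  proof -
    obtain e where "\<And>t. t \<in> {0..1} \<Longrightarrow> \<bar>\<psi> t\<bar> \<le> e"
      using continuous_on_Icc_bound[OF \<psi>] by blast
    then show ?thesis using int[OF \<psi>] by blast
  qed
  show "set_integrable lborel {0<..} (\<lambda>x. \<phi> (exp (- x)) * G x)" by (rule int'[OF \<phi>])
  have poly: "(LINT x:{0<..}|lborel. p (exp (- x)) * G x) = 0" if pp: "real_polynomial_function p" for p
  proof -
    obtain a n where p: "p = (\<lambda>x. \<Sum>i\<le>n. a i * x ^ i)"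
      using pp unfolding real_polynomial_function_iff_sum by (elim exE)
    have pow: "set_integrable lborel {0<..} (\<lambda>x. exp (- x) ^ i * G x)" for i
      by (rule int'[of "\<lambda>t. t ^ i"]) (intro continuous_intros)
    have "(LINT x:{0<..}|lborel. p (exp (- x)) * G x)
        = (\<integral>x. (\<Sum>i\<le>n. a i * (indicator {0<..} x * (exp (- x) ^ i * G x))) \<partial>lborel)"
      unfolding p set_lebesgue_integral_def
      by (simp add: sum_distrib_left sum_distrib_right mult_ac)
    also have "\<dots> = (\<Sum>i\<le>n. \<integral>x. a i * (indicator {0<..} x * (exp (- x) ^ i * G x)) \<partial>lborel)"
      using pow by (intro Bochner_Integration.integral_sum) (auto simp: set_integrable_def)
    also have "\<dots> = 0"
      using moments by (simp add: set_lebesgue_integral_def exp_of_nat_mult[symmetric])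
    finally show ?thesis .
  qed
  have "\<bar>LINT x:{0<..}|lborel. \<phi> (exp (- x)) * G x\<bar> \<le> e" if "0 < e" for e
  proof -
    define M where "M = (\<integral>x. \<bar>?G x\<bar> \<partial>lborel)"
    have M: "0 \<le> M" unfolding M_def by simp
    have "0 < e / (M + 1)" using M that by simp
    then obtain p where p: "real_polynomial_function p" "\<And>t. t \<in> {0..1} \<Longrightarrow> \<bar>\<phi> t - p t\<bar> < e / (M + 1)"
      using Stone_Weierstrass_real_polynomial_function[OF compact_Icc \<phi>] by blast
    have pc: "continuous_on {0..1} p"
      using p(1) by (intro continuous_on_polymonial_function) (simp add: real_polynomial_function_eq)
    have "continuous_on {0..1} (\<lambda>t. \<phi> t - p t)" by (intro continuous_on_diff \<phi> pc)
    then have "\<bar>LINT x:{0<..}|lborel. (\<phi> (exp (- x)) - p (exp (- x))) * G x\<bar> \<le> e / (M + 1) * M"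
      unfolding M_def
      using int[of "\<lambda>t. \<phi> t - p t" "e / ((\<integral>x. \<bar>?G x\<bar> \<partial>lborel) + 1)"] p(2)[unfolded M_def] less_imp_le by blast
    also have "e / (M + 1) * M \<le> e" using M that by (simp add: field_simps)
    also have "(LINT x:{0<..}|lborel. (\<phi> (exp (- x)) - p (exp (- x))) * G x)
        = (LINT x:{0<..}|lborel. \<phi> (exp (- x)) * G x) - (LINT x:{0<..}|lborel. p (exp (- x)) * G x)"
      using set_integral_diff(2)[OF int'[OF \<phi>] int'[OF pc]] by (simp add: left_diff_distrib)
    finally show ?thesis using poly[OF p(1)] by simp
  qed
  then show "(LINT x:{0<..}|lborel. \<phi> (exp (- x)) * G x) = 0"
    using field_le_epsilon[of "\<bar>LINT x:{0<..}|lborel. \<phi> (exp (- x)) * G x\<bar>" 0] by simp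
qed

text \<open>In the variable \<open>t = exp (- x)\<close> the hypothesis says that all moments of a function on \<open>[0,1]\<close>
  vanish.\<close>

lemma laplace_zero:
  fixes G :: "real \<Rightarrow> real"
  assumes cont: "continuous_on {0<..} G" and G: "set_integrable lborel {0<..} G"
    and moments: "\<And>n::nat. (LINT x:{0<..}|lborel. exp (- real n * x) * G x) = 0"
    and y: "0 < y"
  shows "G y = 0"
proof (rule ccontr)
  assume nz: "G y \<noteq> 0"
  have "isCont G y" using cont y by (simp add: continuous_on_eq_continuous_at)
  then have "eventually (\<lambda>x. \<bar>G x - G y\<bar> < \<bar>G y\<bar>) (nhds y)"
    using nz tendstoD[of G "G y" "nhds y" "\<bar>G y\<bar>"]
    by (simp add: continuous_at tendsto_at_iff_tendsto_nhds dist_real_def)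
  then obtain d where d: "0 < d" "\<And>x. \<bar>x - y\<bar> < d \<Longrightarrow> \<bar>G x - G y\<bar> < \<bar>G y\<bar>"
    by (auto simp: eventually_nhds_metric dist_real_def)
  have pos: "0 < G y * G x" if "\<bar>x - y\<bar> < d" for x
    using d(2)[OF that] by (auto simp: zero_less_mult_iff)
  \<comment> \<open>The test function below is a parabola cut off at zero, positive exactly where
    \<open>\<bar>x - y\<bar> < d\<close>. The factor \<open>G y\<close> gives it the sign of
    \<open>G\<close> there, so the integrand is nonnegative. If \<open>y < d\<close>, then
    \<open>b > 1\<close>, which does not affect continuity on \<open>[0,1]\<close>.\<close>
  define a b where "a = exp (- (y + d))" and "b = exp (- (y - d))"
  define \<phi> where "\<phi> t = G y * max 0 ((t - a) * (b - t))" for t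
  have \<phi>: "continuous_on {0..1} \<phi>" unfolding \<phi>_def by (intro continuous_intros)
  have inside: "0 < (exp (- x) - a) * (b - exp (- x)) \<longleftrightarrow> \<bar>x - y\<bar> < d" for x
    using d(1) by (auto simp: a_def b_def zero_less_mult_iff)
  let ?F = "\<lambda>x. indicator {0<..} x *\<^sub>R (\<phi> (exp (- x)) * G x)"
  have F: "0 \<le> ?F x" for x
  proof (cases "\<bar>x - y\<bar> < d")
    case True
    have "0 \<le> max 0 ((exp (- x) - a) * (b - exp (- x))) * (G y * G x)"
      using less_imp_le[OF pos[OF True]] by (rule mult_nonneg_nonneg[rotated]) simp
    then show ?thesis by (simp add: \<phi>_def indicator_def mult_ac)
  next
    case False
    then show ?thesis using inside[of x] by (simp add: \<phi>_def max_def)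
  qed
  have "integrable lborel ?F" "integral\<^sup>L lborel ?F = 0"
    using weighted_moments_zero[OF G moments \<phi>] by (simp_all add: set_integrable_def set_lebesgue_integral_def)
  then have z: "AE x in lborel. ?F x = 0"
    using integral_nonneg_eq_0_iff_AE[of lborel ?F] F by auto
  \<comment> \<open>The right half of the neighbourhood lies in \<open>(0,\<infinity>)\<close> even
    if \<open>y - d\<close> is negative, and it has positive measure.\<close>
  have "AE x in lborel. x \<notin> {y<..<y + d}"
    using z
  proof eventually_elim
    case (elim x)
    show ?case
    proof
      assume x: "x \<in> {y<..<y + d}"
      then have i: "\<bar>x - y\<bar> < d" by auto
      then have "0 < (exp (- x) - a) * (b - exp (- x)) * (G y * G x)"
        using pos[OF i] inside[of x] i by (intro mult_pos_pos[of "_ * _" "_ * _"]) blast+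
      moreover have "max 0 ((exp (- x) - a) * (b - exp (- x))) = (exp (- x) - a) * (b - exp (- x))"
        using inside[of x] i by (simp add: max_def)
      ultimately show False using elim x y by (auto simp: \<phi>_def)
    qed
  qed
  then have "{y<..<y + d} \<in> null_sets lborel" by (subst AE_iff_null_sets) auto
  then show False using d(1) by (auto simp: null_sets_def)
qed

text \<open>Agreement at \<open>1, 2, 3, ...\<close> suffices, because these are moments. The shift
  by one supplies the factor \<open>exp (- x)\<close>, which makes the difference integrable on
  \<open>(0,\<infinity>)\<close>.\<close>

lemma has_laplace_unique:
  assumes cont: "continuous_on {0<..} a" "continuous_on {0<..} b"
    and L: "\<And>n::nat. \<exists>v. has_laplace a (real n + 1) v \<and> has_laplace b (real n + 1) v"
    and x: "0 < x"
  shows "a x = b x"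
proof -
  let ?G = "\<lambda>x. exp (- x) * (a x - b x)"
  have h: "has_bochner_integral lborel (\<lambda>x. indicator {0<..} x *\<^sub>R (exp (- real n * x) * ?G x)) 0" for n
  proof -
    obtain v where "has_laplace a (real n + 1) v" "has_laplace b (real n + 1) v" using L by blast
    then have "has_bochner_integral lborel (\<lambda>x. indicator {0<..} x * (exp (- (real n + 1) * x) * a x) -
        indicator {0<..} x * (exp (- (real n + 1) * x) * b x)) (v - v)"
      unfolding has_laplace_def by (rule has_bochner_integral_diff)
    moreover have "indicator {0<..} x * (exp (- (real n + 1) * x) * a x) -
        indicator {0<..} x * (exp (- (real n + 1) * x) * b x) = indicator {0<..} x *\<^sub>R (exp (- real n * x) * ?G x)" for x
    proof -
      have "exp (- (real n + 1) * x) = exp (- real n * x) * exp (- x)"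
        by (simp add: exp_add[symmetric] algebra_simps)
      then show ?thesis by (simp add: right_diff_distrib mult.assoc)
    qed
    ultimately show ?thesis by simp
  qed
  have "?G x = 0"
  proof (rule laplace_zero[OF _ _ _ x])
    show "continuous_on {0<..} ?G" by (intro continuous_intros cont)
    show "set_integrable lborel {0<..} ?G"
      using h[of 0] by (simp add: set_integrable_def has_bochner_integral_iff)
    show "(LINT x:{0<..}|lborel. exp (- real n * x) * ?G x) = 0" for n :: nat
      using h[of n] by (simp add: set_lebesgue_integral_def has_bochner_integral_iff)
  qed
  then show ?thesis by simp
qed

lemma has_laplace_one:
  assumes "0 < l"
  shows "has_laplace (\<lambda>_. 1) l (1 / l)"
  unfolding has_laplace_def
proof (rule has_bochner_integral_nn_integral)
  have "(\<integral>\<^sup>+x. ennreal (exp (- l * x)) * indicator {0..} x \<partial>lborel) = ennreal (0 - (- exp (- l * 0) / l))"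
  proof (rule nn_integral_FTC_atLeast)
    show "DERIV (\<lambda>x. - exp (- l * x) / l) x :> exp (- l * x)" for x
      using assms by (auto intro!: derivative_eq_intros)
    have "filterlim (\<lambda>x. - l * x) at_bot at_top"
      by (rule filterlim_tendsto_neg_mult_at_bot[OF tendsto_const _ filterlim_ident]) (use assms in simp)
    then have "((\<lambda>x. exp (- l * x)) \<longlongrightarrow> 0) at_top"
      by (rule filterlim_compose[OF exp_at_bot])
    then show "((\<lambda>x. - exp (- l * x) / l) \<longlongrightarrow> 0) at_top"
      using tendsto_divide[OF tendsto_minus tendsto_const[of l]] assms by fastforce
  qed (auto simp: assms)
  also have "(\<integral>\<^sup>+x. ennreal (exp (- l * x)) * indicator {0..} x \<partial>lborel)
      = (\<integral>\<^sup>+x. ennreal (indicator {0<..} x * (exp (- l * x) * 1)) \<partial>lborel)"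
    by (rule nn_integral_cong_AE, use AE_lborel_singleton[of 0] in eventually_elim)
       (auto simp: indicator_def)
  finally show "(\<integral>\<^sup>+x. ennreal (indicator {0<..} x * (exp (- l * x) * 1)) \<partial>lborel) = ennreal (1 / l)"
    by simp
qed (use assms in auto)

section \<open>The transform of a convolution\<close>

lemma kernel_conv_continuous:
  assumes "decreasing_kernel a" "decreasing_kernel b"
  shows "continuous_on {0<..} (conv a b)"
proof -
  have *: "continuous_on {0<..T} (conv a b)" for T
    using continuous_on_kernel_integral[OF assms(2,1), of T "\<lambda>_. 1"]
    by (simp add: kernel_integral_def[abs_def] conv_def[abs_def] mult.commute)
  have "isCont (conv a b) x" if "0 < x" for x
  proof -
    have "continuous_on {0<..<x + 1} (conv a b)" by (rule continuous_on_subset[OF *[of "x + 1"]]) auto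
    then show ?thesis using that by (simp add: continuous_on_eq_continuous_at)
  qed
  then show ?thesis by (simp add: continuous_at_imp_continuous_on)
qed

text \<open>As \<open>exp (- l * x)\<close> splits into
  \<open>exp (- l * (x - s)) * exp (- l * s)\<close>, the claim says that the convolution of the
  nonnegative functions \<open>F\<close> and \<open>G\<close> on the line has mass
  \<open>A * B\<close>. In extended nonnegative integrals Tonelli yields integrability and value
  together.\<close>

lemma has_laplace_conv:
  assumes a: "decreasing_kernel a" and b: "decreasing_kernel b"
    and A: "has_laplace a l A" and B: "has_laplace b l B"
  shows "has_laplace (conv a b) l (A * B)"
proof -
  note [measurable] = decreasing_kernelD(1)[OF a] decreasing_kernelD(1)[OF b]
  define F G where "F x = indicator {0<..} x * (exp (- l * x) * a x)"
    and "G x = indicator {0<..} x * (exp (- l * x) * b x)" for x :: real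
  have [measurable]: "F \<in> borel_measurable borel" "G \<in> borel_measurable borel"
    unfolding F_def G_def by measurable
  have nn: "0 \<le> F x" "0 \<le> G x" for x
    using decreasing_kernelD(3)[OF a] decreasing_kernelD(3)[OF b] by (auto simp: F_def G_def indicator_def)
  have hF: "integrable lborel F" "integral\<^sup>L lborel F = A" and hG: "integrable lborel G" "integral\<^sup>L lborel G = B"
    using A B by (simp_all add: has_laplace_def F_def[abs_def] G_def[abs_def] has_bochner_integral_iff)
  have AB: "0 \<le> A" "0 \<le> B"
    using hF(2) hG(2) nn by (auto intro!: Bochner_Integration.integral_nonneg)
  have nF: "(\<integral>\<^sup>+x. ennreal (F x) \<partial>lborel) = ennreal A" and nG: "(\<integral>\<^sup>+x. ennreal (G x) \<partial>lborel) = ennreal B"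
    using nn_integral_eq_integral[OF hF(1)] nn_integral_eq_integral[OF hG(1)] nn hF(2) hG(2) by auto
  let ?H = "\<lambda>x. indicator {0<..} x * (exp (- l * x) * conv a b x)"
  have conv_nn: "0 \<le> conv a b x" for x
    unfolding conv_def set_lebesgue_integral_def
    using decreasing_kernelD(3)[OF a] decreasing_kernelD(3)[OF b]
    by (intro Bochner_Integration.integral_nonneg) (auto simp: indicator_def)
  have H: "ennreal (?H x) = (\<integral>\<^sup>+s. ennreal (F (x - s)) * ennreal (G s) \<partial>lborel)" for x
  proof -
    have eq: "F (x - s) * G s = exp (- l * x) * (indicator {0<..<x} s *\<^sub>R (a (x - s) * b s))" for s
    proof -
      have "exp (- l * (x - s)) * exp (- l * s) = exp (- l * x)"
        by (simp add: exp_add[symmetric] algebra_simps)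
      then show ?thesis by (auto simp: F_def G_def indicator_def)
    qed
    have i: "integrable lborel (\<lambda>s. indicator {0<..<x} s *\<^sub>R (a (x - s) * b s))"
      using kernel_product_integrable[OF b a, of x] by (simp add: set_integrable_def mult.commute)
    have "(\<integral>\<^sup>+s. ennreal (F (x - s)) * ennreal (G s) \<partial>lborel) = (\<integral>\<^sup>+s. ennreal (F (x - s) * G s) \<partial>lborel)"
      using nn by (simp add: ennreal_mult)
    also have "\<dots> = ennreal (\<integral>s. F (x - s) * G s \<partial>lborel)"
    proof (rule nn_integral_eq_integral)
      show "integrable lborel (\<lambda>s. F (x - s) * G s)" unfolding eq by (rule integrable_mult_right[OF i])
      show "AE s in lborel. 0 \<le> F (x - s) * G s" using nn by simp
    qed
    also have "(\<integral>s. F (x - s) * G s \<partial>lborel) = exp (- l * x) * conv a b x"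
      unfolding eq conv_def set_lebesgue_integral_def by simp
    also have "\<dots> = ?H x"
    proof (cases "0 < x")
      case False
      then have "{0<..<x} = {}" by auto
      then show ?thesis using False by (simp add: conv_def set_lebesgue_integral_def)
    qed simp
    finally show ?thesis by simp
  qed
  have "(\<integral>\<^sup>+x. ennreal (?H x) \<partial>lborel) = (\<integral>\<^sup>+s. \<integral>\<^sup>+x. ennreal (F (x - s)) * ennreal (G s) \<partial>lborel \<partial>lborel)"
    unfolding H by (rule lborel_pair.Fubini') simp
  also have "\<dots> = (\<integral>\<^sup>+s. ennreal A * ennreal (G s) \<partial>lborel)"
  proof (intro nn_integral_cong)
    fix s
    have "(\<integral>\<^sup>+x. ennreal (F x) \<partial>lborel) = ennreal \<bar>1\<bar> * (\<integral>\<^sup>+x. ennreal (F (- s + 1 * x)) \<partial>lborel)"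
      by (rule nn_integral_real_affine) auto
    then have "(\<integral>\<^sup>+x. ennreal (F (x - s)) \<partial>lborel) = ennreal A" using nF by simp
    then show "(\<integral>\<^sup>+x. ennreal (F (x - s)) * ennreal (G s) \<partial>lborel) = ennreal A * ennreal (G s)"
      by (simp add: nn_integral_multc)
  qed
  also have "\<dots> = ennreal (A * B)" using nG AB by (simp add: nn_integral_cmult ennreal_mult)
  finally have "(\<integral>\<^sup>+x. ennreal (?H x) \<partial>lborel) = ennreal (A * B)" .
  moreover have "?H \<in> borel_measurable lborel"
  proof -
    have "continuous_on {0<..} (\<lambda>x. exp (- l * x) * conv a b x)"
      by (intro continuous_intros kernel_conv_continuous a b)
    from continuous_imp_restr_measurable[OF this] show ?thesis by simp
  qed
  ultimately show ?thesis
    unfolding has_laplace_def using AB conv_nn by (intro has_bochner_integral_nn_integral) auto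
qed

text \<open>Both \<open>a * b\<close> and \<open>1\<close> are continuous on
  \<open>(0,\<infinity>)\<close>, so equality of the transforms gives the identity at every point
  and not merely almost everywhere.\<close>

theorem sonine_from_laplace:
  assumes a: "decreasing_kernel a" and b: "decreasing_kernel b"
    and A: "\<And>l. 0 < l \<Longrightarrow> has_laplace a l (f l / l)" and B: "\<And>l. 0 < l \<Longrightarrow> has_laplace b l (1 / f l)"
    and f: "\<And>l. 0 < l \<Longrightarrow> f l \<noteq> 0" and x: "0 < x"
  shows "conv a b x = 1"
proof (rule has_laplace_unique[OF kernel_conv_continuous[OF a b] _ _ x])
  show "\<exists>v. has_laplace (conv a b) (real n + 1) v \<and> has_laplace (\<lambda>_. 1) (real n + 1) v" for n :: nat
    using has_laplace_conv[OF a b A[of "real n + 1"] B[of "real n + 1"]] f[of "real n + 1"]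
      has_laplace_one[of "real n + 1"] by auto
qed auto

section \<open>The Sonine pair of a complete Bernstein function\<close>

lemma completely_monotoneD:
  assumes "completely_monotone g"
  shows "continuous_on {0<..} g" "\<And>x. 0 < x \<Longrightarrow> 0 \<le> g x" "\<And>x y. 0 < x \<Longrightarrow> x \<le> y \<Longrightarrow> g y \<le> g x"
proof -
  have cm: "(deriv ^^ n) g differentiable (at x)" "0 \<le> (-1) ^ n * (deriv ^^ n) g x" if "0 < x" for n x
    using assms that by (auto simp: completely_monotone_def)
  have diff: "g differentiable (at x)" if "0 < x" for x using cm(1)[OF that, of 0] by simp
  then show "continuous_on {0<..} g"
    by (auto intro!: continuous_at_imp_continuous_on differentiable_imp_continuous_within)
  show "0 \<le> g x" if "0 < x" for x using cm(2)[OF that, of 0] by simp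
  show "g y \<le> g x" if "0 < x" "x \<le> y" for x y
  proof (rule DERIV_nonpos_imp_nonincreasing[OF that(2)])
    fix z assume z: "x \<le> z" "z \<le> y"
    then have "0 < z" using that by simp
    then have "DERIV g z :> deriv g z" "deriv g z \<le> 0"
      using diff[of z] cm(2)[of z 1] by (auto simp: real_differentiable_def DERIV_imp_deriv)
    then show "\<exists>D. DERIV g z :> D \<and> D \<le> 0" by blast
  qed
qed

text \<open>Integrability near \<open>0\<close> is read off from the transform at one point
  \<open>l\<close>, because \<open>exp (- l * s) \<ge> exp (- l * x)\<close> for
  \<open>s < x\<close>. The extension by zero gives measurability on the line, whatever
  \<open>a\<close> is on \<open>{..0}\<close>.\<close>

lemma decreasing_kernel_zero_extension:
  fixes a :: "real \<Rightarrow> real"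
  assumes "continuous_on {0<..} a" "\<And>x. 0 < x \<Longrightarrow> 0 \<le> a x" "\<And>x y. 0 < x \<Longrightarrow> x \<le> y \<Longrightarrow> a y \<le> a x"
    and L: "has_laplace a l v" and l: "0 \<le> l"
  shows "decreasing_kernel (\<lambda>x. indicator {0<..} x * a x)"
  unfolding decreasing_kernel_def
proof (intro conjI allI impI)
  let ?a = "\<lambda>x. indicator {0<..} x * a x"
  show m: "?a \<in> borel_measurable borel"
    by (rule continuous_imp_restr_measurable[OF assms(1)]) simp
  show "continuous_on {0<..} ?a"
    using assms(1) by (rule continuous_on_cong[THEN iffD1, rotated -1]) auto
  show "?a y \<le> ?a x" if "0 < x" "x \<le> y" for x y
    using that assms(3) by auto
  show "set_integrable lborel {0<..<x} ?a" for x
    unfolding set_integrable_def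
  proof (rule Bochner_Integration.integrable_bound)
    show "integrable lborel (\<lambda>s. exp (l * x) * (indicator {0<..} s * (exp (- l * s) * a s)))"
      using L by (simp add: has_laplace_def has_bochner_integral_iff)
    show "(\<lambda>s. indicator {0<..<x} s *\<^sub>R ?a s) \<in> borel_measurable lborel" using m by simp
    have "\<bar>a s\<bar> \<le> exp (l * x) * (exp (- l * s) * \<bar>a s\<bar>)" if "0 < s" "s < x" for s
    proof -
      have "0 \<le> l * (x - s)" using l that by simp
      then have "1 \<le> exp (l * x) * exp (- l * s)" by (simp add: exp_add[symmetric] algebra_simps)
      from mult_right_mono[OF this, of "\<bar>a s\<bar>"] show ?thesis by simp
    qed
    then show "AE s in lborel. norm (indicator {0<..<x} s *\<^sub>R ?a s)
        \<le> norm (exp (l * x) * (indicator {0<..} s * (exp (- l * s) * a s)))"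
      by (intro AE_I2) (auto simp: indicator_def abs_mult)
  qed
qed (use assms(2) in auto)

section \<open>The tail of a measure with a decreasing density\<close>

locale levy_density =
  fixes g :: "real \<Rightarrow> real" and \<mu> :: "real measure"
  assumes g_cont: "continuous_on {0<..} g" and g_nonneg: "\<And>x. 0 < x \<Longrightarrow> 0 \<le> g x"
    and g_anti: "\<And>x y. 0 < x \<Longrightarrow> x \<le> y \<Longrightarrow> g y \<le> g x"
    and \<mu>: "\<mu> = density lborel (\<lambda>x. ennreal (indicator {0<..} x * g x))"
    and min_int: "integrable \<mu> (\<lambda>x. min 1 x)"
begin

abbreviation "w \<equiv> \<lambda>x. indicator {0<..} x * g x"

lemma w_measurable [measurable]: "w \<in> borel_measurable borel"
  by (rule continuous_imp_restr_measurable[OF g_cont]) simp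

lemma w_nonneg: "0 \<le> w x"
  using g_nonneg by (simp add: indicator_def)

lemma integrable_iff:
  assumes "h \<in> borel_measurable borel"
  shows "integrable \<mu> h \<longleftrightarrow> integrable lborel (\<lambda>x. w x * h x)"
  unfolding \<mu> using integrable_density[of h lborel w] assms w_nonneg by simp

lemma integral_eq:
  assumes "h \<in> borel_measurable borel"
  shows "integral\<^sup>L \<mu> h = integral\<^sup>L lborel (\<lambda>x. w x * h x :: real)"
  unfolding \<mu> using integral_density[of h lborel w] assms w_nonneg by simp

lemma integrable_min: "integrable lborel (\<lambda>x. w x * min 1 x)"
  using min_int by (subst (asm) integrable_iff) auto

lemma w_integrable_Ioi:
  assumes "0 < s"
  shows "integrable lborel (\<lambda>x. w x * indicator {s<..} x)"
proof (rule Bochner_Integration.integrable_bound)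
  \<comment> \<open>For \<open>x > s\<close> one has \<open>min 1 x \<ge> min 1 s\<close>, which
    explains the constant.\<close>
  show "integrable lborel (\<lambda>x. inverse (min 1 s) * (w x * min 1 x))"
    using integrable_min by simp
  have "w x * indicator {s<..} x \<le> inverse (min 1 s) * (w x * min 1 x)" for x
  proof (cases "s < x")
    case True
    have "1 \<le> inverse (min 1 s) * min 1 x" using True assms by (auto simp: min_def field_simps)
    from mult_left_mono[OF this w_nonneg[of x]] True show ?thesis by (simp add: mult_ac)
  next
    case False
    then show ?thesis using assms g_nonneg[of x] by (cases "0 < x") auto
  qed
  then show "AE x in lborel. norm (w x * indicator {s<..} x) \<le> norm (inverse (min 1 s) * (w x * min 1 x))"
    using w_nonneg by (intro AE_I2) (smt (verit) indicator_pos_le mult_nonneg_nonneg real_norm_def)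
qed measurable

text \<open>True for every \<open>s\<close>: where the mass is infinite, \<open>measure\<close> and
  the integral both take the default value \<open>0\<close>.\<close>

lemma tail_eq: "tail \<mu> s = (\<integral>x. w x * indicator {s<..} x \<partial>lborel)"
proof -
  have "tail \<mu> s = integral\<^sup>L \<mu> (indicator {s<..})"
    by (simp add: tail_def \<mu>)
  then show ?thesis by (subst (asm) integral_eq) auto
qed

lemma tail_nonneg: "0 \<le> tail \<mu> s"
  by (simp add: tail_def)

text \<open>The density is at least \<open>g y\<close> on \<open>(x,y]\<close>. This quantitative
  form yields monotonicity and, once \<open>g y > 0\<close>, strict monotonicity.\<close>

lemma tail_diff_ge:
  assumes "0 < x" "x \<le> y"
  shows "tail \<mu> y + (y - x) * g y \<le> tail \<mu> x"
proof -
  have i: "integrable lborel (\<lambda>t. g y * indicator {x<..y} t)"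
    using assms by simp
  have "tail \<mu> y + (y - x) * g y
      = (\<integral>t. w t * indicator {y<..} t + g y * indicator {x<..y} t \<partial>lborel)"
    using assms i w_integrable_Ioi[of y] by (simp add: tail_eq)
  also have "\<dots> \<le> (\<integral>t. w t * indicator {x<..} t \<partial>lborel)"
    using assms i w_integrable_Ioi[of y] w_integrable_Ioi[of x] g_anti
    by (intro integral_mono) (auto simp: indicator_def)
  finally show ?thesis by (simp add: tail_eq)
qed

lemma tail_antimono: "0 < x \<Longrightarrow> x \<le> y \<Longrightarrow> tail \<mu> y \<le> tail \<mu> x"
  using tail_diff_ge[of x y] g_nonneg[of y] by (smt (verit) mult_nonneg_nonneg)

text \<open>A measure with a density has no atoms: the indicators of \<open>{X n<..}\<close>
  converge at every \<open>t \<noteq> x\<close>, and the point \<open>x\<close> is null.\<close>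

lemma tail_continuous: "continuous_on {0<..} (tail \<mu>)"
proof -
  have *: "continuous_on {c..} (tail \<mu>)" if c: "0 < c" for c
    unfolding continuous_on_sequentially o_def
  proof (intro allI ballI impI, elim conjE)
    fix X x assume X: "\<forall>n. X n \<in> {c..}" "X \<longlonglongrightarrow> x" and x: "x \<in> {c..}"
    have c2: "0 < c / 2" using c by simp
    show "(\<lambda>n. tail \<mu> (X n)) \<longlonglongrightarrow> tail \<mu> x"
      unfolding tail_eq
    proof (rule integral_dominated_convergence[OF _ _ w_integrable_Ioi[OF c2]])
      show "AE t in lborel. (\<lambda>n. w t * indicator {X n<..} t) \<longlonglongrightarrow> w t * indicator {x<..} t"
        using AE_lborel_singleton[of x]
      proof eventually_elim
        case (elim t)
        have "eventually (\<lambda>n. indicator {X n<..} t = (indicator {x<..} t :: real)) sequentially"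
        proof (cases "t < x")
          case True
          then show ?thesis using X(2) by (auto simp: order_tendsto_iff indicator_def elim!: eventually_mono)
        next
          case False
          then have "x < t" using elim by simp
          then show ?thesis using X(2) by (auto simp: order_tendsto_iff indicator_def elim!: eventually_mono)
        qed
        then have "(\<lambda>n. indicator {X n<..} t :: real) \<longlonglongrightarrow> indicator {x<..} t"
          by (rule tendsto_eventually)
        then show ?case by (rule tendsto_mult_left)
      qed
      show "AE t in lborel. norm (w t * indicator {X n<..} t) \<le> w t * indicator {c / 2<..} t" for n
        using X(1)[rule_format, of n] g_nonneg c by (intro AE_I2) (auto simp: indicator_def)
    qed measurable
  qed
  have "isCont (tail \<mu>) x" if "0 < x" for x
  proof -
    have "continuous_on {x / 2<..} (tail \<mu>)" by (rule continuous_on_subset[OF *[of "x / 2"]]) (use that in auto)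
    then show ?thesis using that by (simp add: continuous_on_eq_continuous_at)
  qed
  then show ?thesis by (simp add: continuous_at_imp_continuous_on)
qed

lemma exp_integrable:
  assumes "0 < l"
  shows "integrable lborel (\<lambda>x. w x * (1 - exp (- l * x)))"
proof (rule Bochner_Integration.integrable_bound)
  show "integrable lborel (\<lambda>x. max 1 l * (w x * min 1 x))" using integrable_min by simp
  have "\<bar>w x * (1 - exp (- l * x))\<bar> \<le> \<bar>max 1 l * (w x * min 1 x)\<bar>" for x
  proof (cases "0 < x")
    case True
    have "1 - exp (- l * x) \<le> l * x" using exp_ge_add_one_self[of "- l * x"] by simp
    moreover have "l * x \<le> max 1 l * x" using True by (intro mult_right_mono) auto
    moreover have "1 - exp (- l * x) \<le> max 1 l * 1"
      using exp_ge_zero[of "- l * x"] by linarith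
    ultimately have "1 - exp (- l * x) \<le> max 1 l * min 1 x" by (auto simp: min_def)
    moreover have "0 \<le> 1 - exp (- l * x)" using True assms by simp
    ultimately have "\<bar>1 - exp (- l * x)\<bar> \<le> max 1 l * min 1 x" by simp
    from mult_left_mono[OF this w_nonneg[of x]] True g_nonneg[OF True] show ?thesis
      by (simp add: abs_mult mult_ac)
  qed simp
  then show "AE x in lborel. norm (w x * (1 - exp (- l * x))) \<le> norm (max 1 l * (w x * min 1 x))"
    by simp
qed measurable

lemma exponent_mono:
  assumes "0 < l" "l \<le> l'"
  shows "(\<integral>x. 1 - exp (- l * x) \<partial>\<mu>) \<le> (\<integral>x. 1 - exp (- l' * x) \<partial>\<mu>)"
proof -
  have "(\<integral>x. w x * (1 - exp (- l * x)) \<partial>lborel) \<le> (\<integral>x. w x * (1 - exp (- l' * x)) \<partial>lborel)"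
  proof (rule integral_mono[OF exp_integrable exp_integrable])
    show "w x * (1 - exp (- l * x)) \<le> w x * (1 - exp (- l' * x))" for x
    proof (cases "0 < x")
      case True
      then have "exp (- l' * x) \<le> exp (- l * x)" using assms by simp
      then show ?thesis using w_nonneg[of x] by (intro mult_left_mono) auto
    qed simp
  qed (use assms in auto)
  then show ?thesis by (simp add: integral_eq)
qed

text \<open>Tonelli over \<open>0 < x < y\<close>: the tail at \<open>x\<close> is the integral of
  the density over \<open>y > x\<close>, and integrating \<open>exp (- l * x)\<close> over
  \<open>(0,y)\<close> first gives \<open>(1 - exp (- l * y)) / l\<close>.\<close>

lemma has_laplace_tail:
  assumes l: "0 < l"
  shows "has_laplace (tail \<mu>) l ((\<integral>x. 1 - exp (- l * x) \<partial>\<mu>) / l)"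
  unfolding has_laplace_def
proof (rule has_bochner_integral_nn_integral)
  let ?v = "(\<integral>x. 1 - exp (- l * x) \<partial>\<mu>) / l"
  have wi: "integrable lborel (\<lambda>y. w y * (1 - exp (- l * y)) / l)"
    using exp_integrable[OF l] by simp
  have wn: "0 \<le> w y * (1 - exp (- l * y))" for y
    using w_nonneg[of y] l by (cases "0 < y") auto
  have v: "?v = (\<integral>y. w y * (1 - exp (- l * y)) / l \<partial>lborel)"
    by (simp add: integral_eq)
  show "0 \<le> ?v" unfolding v using wn l by (intro Bochner_Integration.integral_nonneg) auto
  have inner: "(\<integral>\<^sup>+x. ennreal (exp (- l * x)) * indicator {0<..<y} x \<partial>lborel) = ennreal ((1 - exp (- l * y)) / l)"
    if y: "0 < y" for y
  proof -
    have "(\<integral>\<^sup>+x. ennreal (exp (- l * x)) * indicator {0..y} x \<partial>lborel)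
        = ennreal (- exp (- l * y) / l - (- exp (- l * 0) / l))"
      by (rule nn_integral_FTC_Icc) (use l y in \<open>auto intro!: derivative_eq_intros\<close>)
    also have "(\<integral>\<^sup>+x. ennreal (exp (- l * x)) * indicator {0..y} x \<partial>lborel)
        = (\<integral>\<^sup>+x. ennreal (exp (- l * x)) * indicator {0<..<y} x \<partial>lborel)"
      by (rule nn_integral_cong_AE, use AE_lborel_singleton[of 0] AE_lborel_singleton[of y] in eventually_elim)
         (auto simp: indicator_def)
    finally show ?thesis by (simp add: diff_divide_distrib)
  qed
  have swap: "(\<integral>\<^sup>+x. \<integral>\<^sup>+y. ennreal (W y) * (ennreal (exp (- l * x)) * indicator {0<..<y} x) \<partial>lborel \<partial>lborel)
      = (\<integral>\<^sup>+y. \<integral>\<^sup>+x. ennreal (W y) * (ennreal (exp (- l * x)) * indicator {0<..<y} x) \<partial>lborel \<partial>lborel)"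
    if [measurable]: "W \<in> borel_measurable borel" for W :: "real \<Rightarrow> real"
  proof -
    \<comment> \<open>Rewritten so that the condition \<open>x < y\<close>, hidden in the bound of
      an interval, becomes visible as a measurable condition on the pair.\<close>
    have eq: "ennreal (W y) * (ennreal (exp (- l * x)) * indicator {0<..<y} x)
        = (if 0 < x \<and> x < y then ennreal (W y) * ennreal (exp (- l * x)) else 0)" for x y
      by simp
    show ?thesis unfolding eq by (rule lborel_pair.Fubini') measurable
  qed
  have "(\<integral>\<^sup>+x. ennreal (indicator {0<..} x * (exp (- l * x) * tail \<mu> x)) \<partial>lborel)
      = (\<integral>\<^sup>+x. \<integral>\<^sup>+y. ennreal (w y) * (ennreal (exp (- l * x)) * indicator {0<..<y} x) \<partial>lborel \<partial>lborel)"
  proof (intro nn_integral_cong)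
    fix x :: real
    show "ennreal (indicator {0<..} x * (exp (- l * x) * tail \<mu> x))
        = (\<integral>\<^sup>+y. ennreal (w y) * (ennreal (exp (- l * x)) * indicator {0<..<y} x) \<partial>lborel)"
    proof (cases "0 < x")
      case True
      have "ennreal (tail \<mu> x) = (\<integral>\<^sup>+y. ennreal (w y * indicator {x<..} y) \<partial>lborel)"
        unfolding tail_eq using w_integrable_Ioi[OF True] w_nonneg
        by (intro nn_integral_eq_integral[symmetric]) auto
      then have "ennreal (exp (- l * x) * tail \<mu> x)
          = ennreal (exp (- l * x)) * (\<integral>\<^sup>+y. ennreal (w y * indicator {x<..} y) \<partial>lborel)"
        by (simp add: ennreal_mult tail_nonneg)
      also have "\<dots> = (\<integral>\<^sup>+y. ennreal (exp (- l * x)) * ennreal (w y * indicator {x<..} y) \<partial>lborel)"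
        by (rule nn_integral_cmult[symmetric]) measurable
      also have "\<dots> = (\<integral>\<^sup>+y. ennreal (w y) * (ennreal (exp (- l * x)) * indicator {0<..<y} x) \<partial>lborel)"
        using True by (intro nn_integral_cong) (auto simp: indicator_def mult.commute)
      finally show ?thesis using True by simp
    qed auto
  qed
  also have "\<dots> = (\<integral>\<^sup>+y. \<integral>\<^sup>+x. ennreal (w y) * (ennreal (exp (- l * x)) * indicator {0<..<y} x) \<partial>lborel \<partial>lborel)"
    by (rule swap[OF w_measurable])
  also have "\<dots> = (\<integral>\<^sup>+y. ennreal (w y * (1 - exp (- l * y)) / l) \<partial>lborel)"
  proof (intro nn_integral_cong)
    fix y :: real
    have "(\<integral>\<^sup>+x. ennreal (w y) * (ennreal (exp (- l * x)) * indicator {0<..<y} x) \<partial>lborel)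
        = ennreal (w y) * (\<integral>\<^sup>+x. ennreal (exp (- l * x)) * indicator {0<..<y} x \<partial>lborel)"
      by (rule nn_integral_cmult) measurable
    also have "\<dots> = ennreal (w y * (1 - exp (- l * y)) / l)"
    proof (cases "0 < y")
      case True
      then have "0 \<le> (1 - exp (- l * y)) / l" using l by simp
      then show ?thesis
        unfolding inner[OF True] using ennreal_mult[OF w_nonneg[of y], of "(1 - exp (- l * y)) / l"] by simp
    qed simp
    finally show "(\<integral>\<^sup>+x. ennreal (w y) * (ennreal (exp (- l * x)) * indicator {0<..<y} x) \<partial>lborel)
        = ennreal (w y * (1 - exp (- l * y)) / l)" .
  qed
  also have "\<dots> = ennreal ?v"
    unfolding v using wi wn l by (intro nn_integral_eq_integral) auto
  finally show "(\<integral>\<^sup>+x. ennreal (indicator {0<..} x * (exp (- l * x) * tail \<mu> x)) \<partial>lborel) = ennreal ?v" .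
  have "continuous_on {0<..} (\<lambda>x. exp (- l * x) * tail \<mu> x)"
    by (intro continuous_intros tail_continuous)
  from continuous_imp_restr_measurable[OF this]
  show "(\<lambda>x. indicator {0<..} x * (exp (- l * x) * tail \<mu> x)) \<in> borel_measurable lborel" by simp
qed (simp add: tail_nonneg)

text \<open>If the tail vanished beyond \<open>y\<close>, then \<open>f(\<lambda>)/\<lambda>\<close>, the Laplace transform of the tail, would stay
  bounded as \<open>\<lambda> \<rightarrow> 0\<close>.\<close>

lemma tail_pos:
  assumes f: "\<And>l. 0 < l \<Longrightarrow> f l = (\<integral>x. 1 - exp (- l * x) \<partial>\<mu>)"
    and pos: "\<And>l. 0 < l \<Longrightarrow> 0 < f l"
    and lim: "((\<lambda>l. l / f l) \<longlongrightarrow> 0) (at_right 0)" and y: "0 < y"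
  shows "0 < tail \<mu> y"
proof (rule ccontr)
  assume "\<not> 0 < tail \<mu> y"
  then have "tail \<mu> y = 0" using tail_nonneg[of y] by simp
  then have z: "tail \<mu> x = 0" if "y \<le> x" for x using tail_antimono[OF y that] tail_nonneg[of x] by simp
  let ?t = "\<lambda>x. indicator {0<..} x * tail \<mu> x"
  have "decreasing_kernel ?t"
    by (rule decreasing_kernel_zero_extension[OF tail_continuous tail_nonneg tail_antimono has_laplace_tail[of 1]]) auto
  then have i: "integrable lborel (\<lambda>x. indicator {0<..<y} x * ?t x)"
    by (simp add: decreasing_kernel_def set_integrable_def)
  \<comment> \<open>The integral of the whole tail, which is concentrated on \<open>(0,y)\<close>;
    integrability at \<open>0\<close> comes from the kernel property.\<close>
  define M where "M = (\<integral>x. indicator {0<..<y} x * ?t x \<partial>lborel)"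
  have le: "f l / l \<le> M" if l: "0 < l" for l
  proof -
    have h: "integrable lborel (\<lambda>x. indicator {0<..} x * (exp (- l * x) * tail \<mu> x))"
        "(\<integral>x. indicator {0<..} x * (exp (- l * x) * tail \<mu> x) \<partial>lborel) = f l / l"
      using has_laplace_tail[OF l] f[OF l] by (simp_all add: has_laplace_def has_bochner_integral_iff)
    have "(\<integral>x. indicator {0<..} x * (exp (- l * x) * tail \<mu> x) \<partial>lborel) \<le> M"
      unfolding M_def
    proof (rule integral_mono[OF h(1) i])
      show "indicator {0<..} x * (exp (- l * x) * tail \<mu> x) \<le> indicator {0<..<y} x * ?t x" for x
        using l z[of x] tail_nonneg[of x]
        by (cases "x < y") (auto simp: indicator_def intro!: mult_left_le_one_le)
    qed
    then show ?thesis using h(2) by simp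
  qed
  have M: "0 < M" using le[of 1] pos[of 1] by simp
  have "eventually (\<lambda>l. l / f l < 1 / M) (at_right 0)"
    using lim M by (intro order_tendstoD) auto
  then have "eventually (\<lambda>l::real. False) (at_right 0)"
    using eventually_at_right_less[of "0 :: real"]
  proof eventually_elim
    case (elim l)
    then show ?case using le[of l] pos[of l] M by (simp add: field_simps)
  qed
  then show False by simp
qed

text \<open>If \<open>g y = 0\<close>, then \<open>g\<close> would vanish beyond \<open>y\<close>,
  being decreasing, and so would the tail at \<open>y\<close>. Hence \<open>g y > 0\<close> and
  \<open>tail_diff_ge\<close> is strict.\<close>

lemma tail_strict:
  assumes pos: "\<And>y. 0 < y \<Longrightarrow> 0 < tail \<mu> y" and "0 < x" "x < y"
  shows "tail \<mu> y < tail \<mu> x"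
proof -
  have "0 < g y"
  proof (rule ccontr)
    assume "\<not> 0 < g y"
    then have "g t = 0" if "y \<le> t" for t
      using g_anti[of y t] g_nonneg[of t] that assms by auto
    then have "w t * indicator {y<..} t = 0" for t by (cases "y < t") auto
    then have "tail \<mu> y = 0" unfolding tail_eq by (simp only: Bochner_Integration.integral_zero)
    then show False using pos[of y] assms by simp
  qed
  then have "0 < (y - x) * g y" using assms by simp
  then show ?thesis using tail_diff_ge[of x y] assms by simp
qed

end

text \<open>Since \<open>m\<close> is strictly decreasing, \<open>m(x) \<kappa>(x) < (m * k)(x) = 1\<close>.\<close>

lemma strict_kernel_product:
  assumes m: "decreasing_kernel m" and k: "decreasing_kernel k"
    and sonine: "conv m k x = 1" and strict: "\<And>y. 0 < y \<Longrightarrow> y < x \<Longrightarrow> m x < m y" and x: "0 < x"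
  shows "m x * (LINT s:{0<..<x}|lborel. k s) < 1"
proof (rule ccontr)
  assume ge: "\<not> m x * (LINT s:{0<..<x}|lborel. k s) < 1"
  let ?P = "\<lambda>s. indicator {0<..<x} s *\<^sub>R (m (x - s) * k s)" and ?Q = "\<lambda>s. m x * (indicator {0<..<x} s *\<^sub>R k s)"
  have P: "integrable lborel ?P"
    using kernel_product_integrable[OF k m, of x] by (simp add: set_integrable_def mult.commute)
  have Q: "integrable lborel ?Q"
    using decreasing_kernelD(5)[OF k, of x] by (simp add: set_integrable_def)
  have PQ: "?Q s \<le> ?P s" for s
    using strict[of "x - s"] decreasing_kernelD(3)[OF k, of s]
    by (auto simp: indicator_def intro!: mult_right_mono)
  have "integral\<^sup>L lborel ?P \<le> integral\<^sup>L lborel ?Q"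
    using ge sonine by (simp add: conv_def set_lebesgue_integral_def)
  \<comment> \<open>\<open>?Q \<le> ?P\<close> pointwise while the integrals are ordered the other
    way, so both agree almost everywhere. By strictness of \<open>m\<close> this leaves only
    \<open>k = 0\<close> on \<open>(0,x)\<close>, against \<open>m * k = 1\<close>.\<close>
  then have "(\<integral>s. ?P s - ?Q s \<partial>lborel) = 0"
    using integral_mono[OF Q P PQ] by (simp only: Bochner_Integration.integral_diff[OF P Q])
  then have "AE s in lborel. ?P s - ?Q s = 0"
    using integral_nonneg_eq_0_iff_AE[of lborel "\<lambda>s. ?P s - ?Q s"] P Q PQ by simp
  then have "AE s in lborel. ?P s = 0"
  proof eventually_elim
    case (elim s)
    show ?case
    proof (cases "s \<in> {0<..<x}")
      case True
      then have "(m (x - s) - m x) * k s = 0" using elim by (simp add: left_diff_distrib)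
      moreover have "m (x - s) - m x \<noteq> 0" using strict[of "x - s"] True by auto
      ultimately have "k s = 0" by simp
      then show ?thesis by simp
    qed simp
  qed
  then have "integral\<^sup>L lborel ?P = (\<integral>s. 0 \<partial>(lborel :: real measure))"
    using P by (intro integral_cong_AE) auto
  then show False using sonine by (simp add: conv_def set_lebesgue_integral_def)
qed

text \<open>The pointwise strict inequality alone could degenerate at \<open>0\<close>. There the
  limit helps, with the midpoint of \<open>q\<close> and \<open>1\<close> as bound; on the remaining
  compact interval the maximum is attained and thus below \<open>1\<close>.\<close>

lemma uniform_strict_bound:
  fixes F :: "real \<Rightarrow> real"
  assumes cont: "continuous_on {0<..T} F" and lt: "\<And>x. x \<in> {0<..T} \<Longrightarrow> F x < 1"
    and lim: "(F \<longlongrightarrow> q) (at_right 0)" and q: "q < 1" and T: "0 < T"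
  obtains q' where "q' < 1" "\<And>x. x \<in> {0<..T} \<Longrightarrow> F x \<le> q'"
proof -
  have "eventually (\<lambda>x. F x < (q + 1) / 2) (at_right 0)"
    using lim q by (intro order_tendstoD) auto
  then obtain d where d: "0 < d" "\<And>x. 0 < x \<Longrightarrow> x < d \<Longrightarrow> F x < (q + 1) / 2"
    by (auto simp: eventually_at_right_field)
  define c where "c = min d T"
  have c: "0 < c" "c \<le> T" "c \<le> d" using d T by (auto simp: c_def)
  have "continuous_on {c..T} F" by (rule continuous_on_subset[OF cont]) (use c in auto)
  then obtain x0 where x0: "x0 \<in> {c..T}" "\<And>x. x \<in> {c..T} \<Longrightarrow> F x \<le> F x0"
    using continuous_attains_sup[OF compact_Icc, of c T F] c by auto
  show thesis
  proof (rule that[of "max ((q + 1) / 2) (F x0)"])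
    show "max ((q + 1) / 2) (F x0) < 1" using q lt[of x0] x0 c by auto
    show "F x \<le> max ((q + 1) / 2) (F x0)" if "x \<in> {0<..T}" for x
      using d(2)[of x] x0(2)[of x] that c by (cases "x < c") (auto simp: less_imp_le intro: max.coboundedI1 max.coboundedI2)
  qed
qed

section \<open>Independence of the kernel values outside \<open>(0,\<infinity>)\<close>\<close>

lemma K_op_cong_kernels:
  assumes "\<And>x. 0 < x \<Longrightarrow> m' x = m x" "\<And>x. 0 < x \<Longrightarrow> k' x = k x"
  shows "K_op m' k' = K_op m k"
proof (intro ext)
  fix \<phi> x
  have "(LINT r:{0<..<x}|lborel. m' r * k' (x - r) * \<phi> r) = (LINT r:{0<..<x}|lborel. m r * k (x - r) * \<phi> r)"
    using assms by (intro set_lebesgue_integral_cong) auto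
  then show "K_op m' k' \<phi> x = K_op m k \<phi> x" by (simp add: K_op_def)
qed

lemma conv_cong_left:
  assumes "\<And>x. 0 < x \<Longrightarrow> m' x = m x"
  shows "conv m' = conv m"
  by (intro ext conv_cong) (use assms in auto)

lemma I_Ce_cong_kernels:
  assumes "\<And>x. 0 < x \<Longrightarrow> m' x = m x" "\<And>x. 0 < x \<Longrightarrow> k' x = k x"
  shows "I_Ce m' k' = I_Ce m k"
  using K_op_cong_kernels[OF assms] conv_cong_left[OF assms(2)]
  by (simp add: I_Ce_def[abs_def] I_R_def[abs_def])

lemma solves_ivp_cong_kernel:
  assumes "\<And>x. 0 < x \<Longrightarrow> m' x = m x"
  shows "solves_ivp m' T l \<phi>0 \<phi> \<longleftrightarrow> solves_ivp m T l \<phi>0 \<phi>"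
  using assms
  by (auto simp: solves_ivp_def C_Icc_def C_Ioc_def D_Ce_def D_R_def conv_cong_left[OF assms])

theorem theorem4p1:
  fixes f k :: "real \<Rightarrow> real" and \<mu> :: "real measure" and q T \<phi>0 l :: real
  assumes "complete_bernstein f \<mu>"
    and "filterlim (\<lambda>x. 1 / f x) at_top (at_right 0)"
    and "((\<lambda>x. 1 / f x) \<longlongrightarrow> 0) at_top"
    and "((\<lambda>x. x / f x) \<longlongrightarrow> 0) (at_right 0)"
    and "filterlim (\<lambda>x. x / f x) at_top at_top"
    and "potential_density f k"
    and "((\<lambda>x. tail \<mu> x * (LINT s:{0<..<x}|lborel. k s)) \<longlongrightarrow> q) (at_right 0)"
    and "q < 1"
    and "\<not> bounded (f ` {0<..})"
    and "T > 0"
  shows "\<exists>\<phi>. solves_ivp (tail \<mu>) T l \<phi>0 \<phi> \<and>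
             (\<forall>\<psi>. solves_ivp (tail \<mu>) T l \<phi>0 \<psi> \<longrightarrow> (\<forall>x\<in>{0..T}. \<psi> x = \<phi> x)) \<and>
             (\<forall>x\<in>{0..T}.
                summable (\<lambda>j. ((\<lambda>g y. l * I_Ce (tail \<mu>) k g y) ^^ j) (\<lambda>_. 1) x) \<and>
                \<phi> x = \<phi>0 * (\<Sum>j. ((\<lambda>g y. l * I_Ce (tail \<mu>) k g y) ^^ j) (\<lambda>_. 1) x))"
proof -
  obtain g where g: "completely_monotone g"
      "\<mu> = density lborel (\<lambda>x. ennreal (indicator {0<..} x * g x))"
    and min_int: "integrable \<mu> (\<lambda>x. min 1 x)"
    and f: "\<And>l. 0 < l \<Longrightarrow> f l = (\<integral>x. 1 - exp (- l * x) \<partial>\<mu>)"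
    using assms(1) by (auto simp: complete_bernstein_def levy_measure_def)
  interpret levy_density g \<mu>
    using completely_monotoneD[OF g(1)] g(2) min_int by unfold_locales
  note kcm = completely_monotoneD[of k]
  have cm_k: "completely_monotone k" using assms(6) by (simp add: potential_density_def)
  have laplace_k: "has_laplace k l (1 / f l)" if "0 < l" for l
    using assms(6) that
    by (simp add: potential_density_def has_laplace_def has_bochner_integral_iff set_integrable_def
        set_lebesgue_integral_def)
  have laplace_tail: "has_laplace (tail \<mu>) l (f l / l)" if "0 < l" for l
    using has_laplace_tail[OF that] f[OF that] by simp
  have fpos: "0 < f l" if l: "0 < l" for l
  proof -
    \<comment> \<open>The limit gives positivity of \<open>f\<close> near \<open>0\<close>, where
      zeros are excluded because \<open>1 / 0 = 0\<close>; monotonicity of \<open>f\<close> extends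
      it to every \<open>l\<close>.\<close>
    have "eventually (\<lambda>x. 0 < 1 / f x) (at_right 0)"
      using assms(2) unfolding filterlim_at_top_dense by blast
    then obtain d where d: "0 < d" "\<And>x. 0 < x \<Longrightarrow> x < d \<Longrightarrow> 0 < 1 / f x"
      by (auto simp: eventually_at_right_field)
    define x where "x = min (d / 2) l"
    have x: "0 < x" "x < d" "x \<le> l" using d l by (auto simp: x_def)
    then have "0 < f x" using d(2)[of x] by simp
    also have "f x \<le> f l" using exponent_mono[OF x(1,3)] f x l by simp
    finally show ?thesis .
  qed
  \<comment> \<open>The general results ask for Borel functions on the line, but \<open>k\<close> is
    arbitrary on \<open>{..0}\<close>; hence the extensions by zero.\<close>
  define m where "m x = indicator {0<..} x * tail \<mu> x" for x
  define k0 where "k0 x = indicator {0<..} x * k x" for x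
  have m: "decreasing_kernel m"
    unfolding m_def[abs_def]
    by (rule decreasing_kernel_zero_extension[OF tail_continuous tail_nonneg tail_antimono laplace_tail[of 1]]) auto
  have k0: "decreasing_kernel k0"
    unfolding k0_def[abs_def]
    by (rule decreasing_kernel_zero_extension[OF kcm[OF cm_k] laplace_k[of 1]]) auto
  have ext: "has_laplace (\<lambda>x. indicator {0<..} x * a x) l v \<longleftrightarrow> has_laplace a l v" for a l v
    unfolding has_laplace_def by (intro has_bochner_integral_cong) (auto simp: indicator_def)
  have sonine: "conv m k0 x = 1" if "0 < x" for x
  proof (rule sonine_from_laplace[OF m k0 _ _ _ that])
    show "has_laplace m l (f l / l)" "has_laplace k0 l (1 / f l)" if "0 < l" for l
      using laplace_tail[OF that] laplace_k[OF that] by (simp_all add: m_def[abs_def] k0_def[abs_def] ext)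
    show "f l \<noteq> 0" if "0 < l" for l using fpos[OF that] by simp
  qed
  have tail_pos': "0 < tail \<mu> y" if "0 < y" for y
    by (rule tail_pos[OF f fpos assms(4) that])
  let ?F = "\<lambda>x. m x * conv k0 (\<lambda>_. 1) x"
  obtain q' where q': "q' < 1" "\<And>x. x \<in> {0<..T} \<Longrightarrow> ?F x \<le> q'"
  proof (rule uniform_strict_bound)
    have "continuous_on {0<..} ?F"
      by (intro continuous_on_mult decreasing_kernelD(2)[OF m]
          kernel_conv_continuous[OF k0 decreasing_kernel_one])
    then show "continuous_on {0<..T} ?F" by (rule continuous_on_subset) auto
    show "?F x < 1" if "x \<in> {0<..T}" for x
      unfolding conv_one_right
    proof (rule strict_kernel_product[OF m k0 sonine])
      show "m x < m y" if "0 < y" "y < x" for y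
        using tail_strict[OF tail_pos' that] that by (simp add: m_def)
    qed (use that in auto)
    have "eventually (\<lambda>x. tail \<mu> x * (LINT s:{0<..<x}|lborel. k s) = ?F x) (at_right 0)"
      using eventually_at_right_less[of "0 :: real"]
    proof eventually_elim
      case (elim x)
      have "(LINT s:{0<..<x}|lborel. k s) = (LINT s:{0<..<x}|lborel. k0 s)"
        by (rule set_lebesgue_integral_cong) (auto simp: k0_def)
      then show ?case using elim by (simp add: conv_one_right m_def)
    qed
    then show "(?F \<longlongrightarrow> q) (at_right 0)"
      using assms(7) by (rule tendsto_cong[THEN iffD1])
  qed (use assms in auto)
  interpret sonine_kernel m k0 T q'
  proof
    show "\<exists>\<beta>\<ge>0. \<forall>x>0. (LINT s:{0<..<x}|lborel. exp (- \<beta> * s) * k0 s) \<le> e" if e: "0 < e" for e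
    proof -
      \<comment> \<open>As \<open>k \<ge> 0\<close> on \<open>(0,\<infinity>)\<close>, every
        truncated transform is at most the full one, \<open>1 / f b\<close>, so one \<open>b\<close>
        serves all \<open>x\<close>.\<close>
      have "eventually (\<lambda>b. 1 / f b < e) at_top"
        using assms(3) e by (rule order_tendstoD)
      then have "eventually (\<lambda>b. 0 < b \<and> 1 / f b < e) at_top"
        using eventually_gt_at_top[of 0] by eventually_elim simp
      then obtain b where b: "0 < b" "1 / f b < e"
        using eventually_happens' [OF trivial_limit_at_top_linorder] by blast
      have h: "integrable lborel (\<lambda>s. indicator {0<..} s * (exp (- b * s) * k s))"
          "(\<integral>s. indicator {0<..} s * (exp (- b * s) * k s) \<partial>lborel) = 1 / f b"
        using laplace_k[OF b(1)] by (simp_all add: has_laplace_def has_bochner_integral_iff)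
      have "(LINT s:{0<..<x}|lborel. exp (- b * s) * k0 s) \<le> e" for x
      proof -
        have "(LINT s:{0<..<x}|lborel. exp (- b * s) * k0 s)
            \<le> (\<integral>s. indicator {0<..} s * (exp (- b * s) * k s) \<partial>lborel)"
          unfolding set_lebesgue_integral_def
        proof (rule integral_mono[OF _ h(1)])
          have "set_integrable lborel {0<..<x} (\<lambda>s. indicator {0<..} s * (exp (- b * s) * k s))"
            unfolding set_integrable_def by (rule integrable_mult_indicator[OF _ h(1)]) simp
          then show "integrable lborel (\<lambda>s. indicator {0<..<x} s *\<^sub>R (exp (- b * s) * k0 s))"
            unfolding set_integrable_def
            by (rule Bochner_Integration.integrable_cong[THEN iffD1, rotated -1]) (auto simp: k0_def indicator_def)
          show "indicator {0<..<x} s *\<^sub>R (exp (- b * s) * k0 s) \<le> indicator {0<..} s * (exp (- b * s) * k s)" for s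
            using kcm(2)[OF cm_k, of s] by (auto simp: k0_def indicator_def)
        qed
        then show ?thesis using h(2) b(2) by simp
      qed
      then show ?thesis using b(1) by (intro exI[of _ b]) auto
    qed
  qed (use m k0 sonine q' assms in auto)
  have "m x = tail \<mu> x" "k0 x = k x" if "0 < x" for x
    using that by (simp_all add: m_def k0_def)
  then show ?thesis
    using ivp_well_posed[of l \<phi>0] I_Ce_cong_kernels[of m "tail \<mu>" k0 k] solves_ivp_cong_kernel[of m "tail \<mu>"]
    by simp
qed

end
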